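(* Let $J := [0,T]$ for some fixed $T>0$, or $J := \mathbb{R}_+ = [0,\infty)$. Let $(E_0,E_1)$ be a pair of densely embedded complex Banach spaces, and let $A \in \mathcal{B}(E_1,E_0)$ be such that $A$, regarded as an unbounded linear operator on $E_0$ with domain $D(A)=E_1$, is a closed operator on $E_0$. Suppose that $$\big(\mathbb{E}_0(J),\mathbb{E}_1(J)\big) = \big(BUC(J,E_0),\; BUC^1(J,E_0)\cap BUC(J,E_1)\big)$$ is a pair of maximal regularity for $A$. Then $A$ (with domain $D(A)=E_1$) generates a strongly continuous analytic semigroup on $E_0$. Moreover, in the case $J=\mathbb{R}_+$, one has $s(A)<0$, where $s(A) := \sup\{\operatorname{Re}\mu : \mu\in\sigma(A)\}$ is the spectral bound of $A$.
   Context: A pair $(E_0,E_1)$ of Banach spaces, with norms $\|\cdot\|_0$ and $\|\cdot\|_1$, is called a pair of densely embedded Banach spaces if $E_1\subset E_0$, the natural injection $E_1\to E_0$ is continuous, and $E_1$ is a dense subset of $E_0$. $\mathcal{B}(E_1,E_0)$ denotes the bounded linear operators from $E_1$ to $E_0$. $\sigma(A)$ denotes the spectrum of $A$ as an unbounded operator on $E_0$ with domain $E_1$ (with the convention $\sup\emptyset=-\infty$). $BUC(J,E)$ is the Banach space of all bounded uniformly continuous functions $u:J\to E$ with the supremum norm, and $BUC^1(J,E)$ is the space of all functions in $BUC(J,E)$ whose derivative also belongs to $BUC(J,E)$. (If $J=[0,T]$ is compact, these are $C(J,E)$ and $C^1(J,E)$.) The space $\mathbb{E}_1(J)=BUC^1(J,E_0)\cap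 BUC(J,E_1)$ carries its natural norm, equivalent to $\sup_{t\in J}\big(\|\dot u(t)\|_0+\|u(t)\|_1\big)$. The trace operator is $\gamma:\mathbb{E}_1(J)\to E_0$, $\gamma u := u(0)$, and the trace space is $\gamma\mathbb{E}_1 := \{x\in E_0 : x=\gamma u \text{ for some } u\in\mathbb{E}_1(J)\}$ with norm $\|x\|_\gamma := \inf\{\|u\|_{\mathbb{E}_1(J)} : u\in\mathbb{E}_1(J),\ \gamma u = x\}$. (For the spaces considered here, $\gamma\mathbb{E}_1$ coincides with $E_1$.) $(\mathbb{E}_0(J),\mathbb{E}_1(J))$ is called a pair of maximal regularity for $A$ if the map $\left(\frac{d}{dt}-A,\ \gamma\right):\mathbb{E}_1(J)\to\mathbb{E}_0(J)\times\gamma\mathbb{E}_1$ is a (topological linear) isomorphism; that is, for every $(f,x)\in\mathbb{E}_0(J)\times\gamma\mathbb{E}_1$ there is a unique $u\in\mathbb{E}_1(J)$ with $\dot u(t)-Au(t)=f(t)$ for $t\in J$ and $u(0)=x$, and the map $(f,x)\mapsto u$ is continuous. *)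

theory Defs
  imports "HOL-Analysis.Analysis"
begin

text \<open>The library only provides real Banach spaces; complex Banach spaces are obtained by adding
  a compatible complex scalar multiplication.\<close>

class complex_banach = banach +
  fixes scaleC :: "complex \<Rightarrow> 'a \<Rightarrow> 'a" (infixr "*\<^sub>C" 75)
  assumes scaleC_add_right: "c *\<^sub>C (x + y) = c *\<^sub>C x + c *\<^sub>C y"
    and scaleC_add_left: "(c + d) *\<^sub>C x = c *\<^sub>C x + d *\<^sub>C x"
    and scaleC_scaleC: "c *\<^sub>C d *\<^sub>C x = (c * d) *\<^sub>C x"
    and scaleC_of_real: "complex_of_real r *\<^sub>C x = r *\<^sub>R x"
    and norm_scaleC: "norm (c *\<^sub>C x) = cmod c * norm x"

definition bounded_clinear :: "('a::complex_banach \<Rightarrow> 'b::complex_banach) \<Rightarrow> bool" where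
  "bounded_clinear f \<longleftrightarrow> bounded_linear f \<and> (\<forall>c x. f (c *\<^sub>C x) = c *\<^sub>C f x)"

text \<open>The two spaces of a densely embedded pair are two types (each with its own norm), and
  the inclusion of the smaller space is an explicit injection \<open>j\<close>.\<close>

definition densely_embedded :: "('b::complex_banach \<Rightarrow> 'a::complex_banach) \<Rightarrow> bool" where
  "densely_embedded j \<longleftrightarrow> bounded_clinear j \<and> inj j \<and> closure (range j) = UNIV"


subsection \<open>Unbounded operators\<close>

text \<open>An unbounded operator on \<open>'a\<close> is given by its domain \<open>D\<close> and a function \<open>B\<close>, whose values
  outside \<open>D\<close> are irrelevant.  An operator \<open>A\<close> defined on the smaller space of an
  embedded pair becomes an unbounded operator on the larger one with domain \<open>range j\<close>.\<close>

definition unbounded_op :: "('b \<Rightarrow> 'a) \<Rightarrow> ('b \<Rightarrow> 'a) \<Rightarrow> 'a \<Rightarrow> 'a" where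
  "unbounded_op j A x = A (inv j x)"

definition closed_operator :: "'a::complex_banach set \<Rightarrow> ('a \<Rightarrow> 'a) \<Rightarrow> bool" where
  "closed_operator D B \<longleftrightarrow> closed {(x, B x) | x. x \<in> D}"

definition resolvent_set :: "'a::complex_banach set \<Rightarrow> ('a \<Rightarrow> 'a) \<Rightarrow> complex set" where
  "resolvent_set D B =
     {\<mu>. bij_betw (\<lambda>x. \<mu> *\<^sub>C x - B x) D UNIV \<and>
          bounded_clinear (inv_into D (\<lambda>x. \<mu> *\<^sub>C x - B x))}"

definition op_spectrum :: "'a::complex_banach set \<Rightarrow> ('a \<Rightarrow> 'a) \<Rightarrow> complex set" where
  "op_spectrum D B = - resolvent_set D B"

text \<open>Extended reals, so that the supremum is \<open>-\<infinity>\<close> for empty and \<open>\<infinity>\<close> for unbounded sets.\<close>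

definition spectral_bound :: "'a::complex_banach set \<Rightarrow> ('a \<Rightarrow> 'a) \<Rightarrow> ereal" where
  "spectral_bound D B = (SUP \<mu> \<in> op_spectrum D B. ereal (Re \<mu>))"


subsection \<open>Strongly continuous analytic semigroups\<close>

definition C0_semigroup :: "(real \<Rightarrow> 'a::complex_banach \<Rightarrow>\<^sub>L 'a) \<Rightarrow> bool" where
  "C0_semigroup S \<longleftrightarrow>
     (\<forall>t\<ge>0. bounded_clinear (blinfun_apply (S t))) \<and>
     S 0 = id_blinfun \<and>
     (\<forall>s\<ge>0. \<forall>t\<ge>0. S (s + t) = S s o\<^sub>L S t) \<and>
     (\<forall>x. continuous_on {0..} (\<lambda>t. blinfun_apply (S t) x))"

definition is_generator ::
    "(real \<Rightarrow> 'a::complex_banach \<Rightarrow>\<^sub>L 'a) \<Rightarrow> 'a set \<Rightarrow> ('a \<Rightarrow> 'a) \<Rightarrow> bool" where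
  "is_generator S D B \<longleftrightarrow>
     (\<forall>x y. (x \<in> D \<and> B x = y) \<longleftrightarrow>
       ((\<lambda>h. (blinfun_apply (S h) x - x) /\<^sub>R h) \<longlongrightarrow> y) (at_right 0))"

definition sector :: "real \<Rightarrow> complex set" where
  "sector \<theta> = {z. z \<noteq> 0 \<and> \<bar>Arg z\<bar> < \<theta>}"

text \<open>Complex differentiability with respect to the operator norm: the real Frechet
  derivative exists and has the form \<open>h \<mapsto> h D\<close>.\<close>

definition complex_differentiable_op ::
    "(complex \<Rightarrow> 'a::complex_banach \<Rightarrow>\<^sub>L 'a) \<Rightarrow> complex \<Rightarrow> bool" where
  "complex_differentiable_op S z \<longleftrightarrow>
     (\<exists>L D. (S has_derivative L) (at z) \<and>
        (\<forall>h x. blinfun_apply (L h) x = h *\<^sub>C blinfun_apply D x))"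

definition analytic_semigroup :: "real \<Rightarrow> (complex \<Rightarrow> 'a::complex_banach \<Rightarrow>\<^sub>L 'a) \<Rightarrow> bool" where
  "analytic_semigroup \<theta> S \<longleftrightarrow>
     (\<forall>z \<in> sector \<theta>. bounded_clinear (blinfun_apply (S z))) \<and>
     S 0 = id_blinfun \<and>
     (\<forall>z \<in> sector \<theta>. \<forall>w \<in> sector \<theta>. S (z + w) = S z o\<^sub>L S w) \<and>
     (\<forall>z \<in> sector \<theta>. complex_differentiable_op S z) \<and>
     (\<forall>\<theta>' x. 0 < \<theta>' \<and> \<theta>' < \<theta> \<longrightarrow>
        ((\<lambda>z. blinfun_apply (S z) x) \<longlongrightarrow> x) (at 0 within sector \<theta>'))"

definition generates_C0_analytic_semigroup ::
    "'a::complex_banach set \<Rightarrow> ('a \<Rightarrow> 'a) \<Rightarrow> bool" where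
  "generates_C0_analytic_semigroup D B \<longleftrightarrow>
     (\<exists>S. C0_semigroup S \<and> is_generator S D B \<and>
        (\<exists>\<theta> S'. 0 < \<theta> \<and> \<theta> \<le> pi / 2 \<and> analytic_semigroup \<theta> S' \<and>
           (\<forall>t\<ge>0. S' (complex_of_real t) = S t)))"


subsection \<open>Function spaces and maximal regularity\<close>

text \<open>Elements of function spaces on \<open>J\<close> are total functions on \<^typ>\<open>real\<close>, whose values outside
  \<open>J\<close> are irrelevant; accordingly, two of them are identified when they agree on \<open>J\<close>.\<close>

definition BUC :: "real set \<Rightarrow> (real \<Rightarrow> 'a::real_normed_vector) set" where
  "BUC J = {u. bounded (u ` J) \<and> uniformly_continuous_on J u}"

definition sup_norm_on :: "real set \<Rightarrow> (real \<Rightarrow> 'a::real_normed_vector) \<Rightarrow> real" where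
  "sup_norm_on J u = (SUP t\<in>J. norm (u t))"

definition deriv_on :: "real set \<Rightarrow> (real \<Rightarrow> 'a::real_normed_vector) \<Rightarrow> real \<Rightarrow> 'a" where
  "deriv_on J u t = vector_derivative u (at t within J)"

definition BUC1 :: "real set \<Rightarrow> (real \<Rightarrow> 'a::real_normed_vector) set" where
  "BUC1 J = {u \<in> BUC J. (\<forall>t\<in>J. u differentiable (at t within J)) \<and> deriv_on J u \<in> BUC J}"

definition EE1 :: "real set \<Rightarrow> ('b::complex_banach \<Rightarrow> 'a::complex_banach) \<Rightarrow> (real \<Rightarrow> 'b) set" where
  "EE1 J j = {u. j \<circ> u \<in> BUC1 J \<and> u \<in> BUC J}"

definition EE1_norm ::
    "real set \<Rightarrow> ('b::complex_banach \<Rightarrow> 'a::complex_banach) \<Rightarrow> (real \<Rightarrow> 'b) \<Rightarrow> real" where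
  "EE1_norm J j u = (SUP t\<in>J. norm (deriv_on J (j \<circ> u) t) + norm (u t))"

definition trace_space ::
    "real set \<Rightarrow> ('b::complex_banach \<Rightarrow> 'a::complex_banach) \<Rightarrow> 'a set" where
  "trace_space J j = {j (u 0) | u. u \<in> EE1 J j}"

definition trace_norm ::
    "real set \<Rightarrow> ('b::complex_banach \<Rightarrow> 'a::complex_banach) \<Rightarrow> 'a \<Rightarrow> real" where
  "trace_norm J j x = Inf {EE1_norm J j u | u. u \<in> EE1 J j \<and> j (u 0) = x}"

definition solves_cauchy ::
    "real set \<Rightarrow> ('b::complex_banach \<Rightarrow> 'a::complex_banach) \<Rightarrow> ('b \<Rightarrow> 'a)
      \<Rightarrow> (real \<Rightarrow> 'a) \<Rightarrow> 'a \<Rightarrow> (real \<Rightarrow> 'b) \<Rightarrow> bool" where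
  "solves_cauchy J j A f x u \<longleftrightarrow>
     u \<in> EE1 J j \<and> (\<forall>t\<in>J. deriv_on J (j \<circ> u) t - A (u t) = f t) \<and> j (u 0) = x"

text \<open>The map \<open>u \<mapsto> (u' - A u, u(0))\<close> is a topological linear isomorphism: it is well defined
  and bounded, bijective, and the (linear) solution map \<open>(f, x) \<mapsto> u\<close> is continuous, i.e. bounded.\<close>

definition maximal_regularity ::
    "real set \<Rightarrow> ('b::complex_banach \<Rightarrow> 'a::complex_banach) \<Rightarrow> ('b \<Rightarrow> 'a) \<Rightarrow> bool" where
  "maximal_regularity J j A \<longleftrightarrow>
     (\<forall>u \<in> EE1 J j. (\<lambda>t. deriv_on J (j \<circ> u) t - A (u t)) \<in> BUC J) \<and>
     (\<exists>C. \<forall>u \<in> EE1 J j.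
        sup_norm_on J (\<lambda>t. deriv_on J (j \<circ> u) t - A (u t)) + trace_norm J j (j (u 0))
          \<le> C * EE1_norm J j u) \<and>
     (\<forall>f \<in> BUC J. \<forall>x \<in> trace_space J j.
        (\<exists>u. solves_cauchy J j A f x u) \<and>
        (\<forall>u v. solves_cauchy J j A f x u \<longrightarrow> solves_cauchy J j A f x v \<longrightarrow> (\<forall>t\<in>J. u t = v t))) \<and>
     (\<exists>C. \<forall>f \<in> BUC J. \<forall>x \<in> trace_space J j. \<forall>u. solves_cauchy J j A f x u \<longrightarrow>
        EE1_norm J j u \<le> C * (sup_norm_on J f + trace_norm J j x))"

end

theory Submission
  imports Defs
begin

text \<open>
  Constant functions show that the trace space is \<open>E\<^sub>1\<close>, and extending data constantly in time makes
  the maximal regularity estimate causal: it holds on every interval \<open>[0, T]\<close> with \<open>T \<in> J\<close>, with one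
  constant. On the half line this is uniform in \<open>T\<close>; on a compact interval it becomes uniform in \<open>T\<close>
  for \<open>A - \<omega>\<close> with \<open>\<omega>\<close> large, so only the uniform case has to be treated.

  Uniform regularity gives the resolvent on \<open>Re \<mu> > 0\<close>: for surjectivity of \<open>\<mu> - A\<close>, take a solution
  \<open>u\<close> of \<open>u' - A u = exp (\<mu> t) y\<close> for which \<open>exp (- \<mu> t) u\<close> is periodic and average it over a period. Since
  uniform regularity survives small perturbations, \<open>A + \<epsilon>\<close> has the same property, whence \<open>s(A) < 0\<close>.

  By scaling and perturbation, \<open>u' - \<zeta> A u = f\<close> is uniquely solvable on \<open>[0, 1]\<close> for all \<open>\<zeta>\<close> in a
  sector around the positive half line. The value at time 1 of the solution with \<open>f = 0\<close> and
  \<open>u 0 = x\<close> depends holomorphically on \<open>\<zeta>\<close> and satisfies the semigroup law by uniqueness.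
  This semigroup on \<open>E\<^sub>1\<close> is carried over to \<open>E\<^sub>0\<close> by the isomorphism \<open>1 - A\<close>; no contour integral
  is needed.
\<close>

section \<open>Complex scalars and solutions of the inhomogeneous equation\<close>

lemma bounded_bilinear_scaleC:
  "bounded_bilinear (scaleC :: complex \<Rightarrow> 'a::complex_banach \<Rightarrow> 'a)"
proof
  fix a a' c :: complex and b b' :: 'a and r :: real
  show "(a + a') *\<^sub>C b = a *\<^sub>C b + a' *\<^sub>C b" by (rule scaleC_add_left)
  show "a *\<^sub>C (b + b') = a *\<^sub>C b + a *\<^sub>C b'" by (rule scaleC_add_right)
  show "(r *\<^sub>R a) *\<^sub>C b = r *\<^sub>R (a *\<^sub>C b)"
    by (metis scaleC_scaleC scaleC_of_real scaleR_conv_of_real)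
  show "a *\<^sub>C (r *\<^sub>R b) = r *\<^sub>R (a *\<^sub>C b)"
    by (metis scaleC_scaleC scaleC_of_real mult.commute)
  show "\<exists>K. \<forall>(a::complex) (b::'a). norm (a *\<^sub>C b) \<le> norm a * norm b * K"
    by (rule exI[of _ 1]) (simp add: norm_scaleC)
qed

interpretation scaleC: bounded_bilinear "scaleC :: complex \<Rightarrow> 'a::complex_banach \<Rightarrow> 'a"
  by (rule bounded_bilinear_scaleC)

declare scaleC.zero_left [simp] scaleC.zero_right [simp] scaleC.minus_left [simp]
  scaleC.minus_right [simp] norm_scaleC [simp]

lemma scaleC_one [simp]: "1 *\<^sub>C x = (x :: 'a::complex_banach)"
  using scaleC_of_real[of 1 x] by simp

lemma scaleC_left_commute: "a *\<^sub>C b *\<^sub>C x = b *\<^sub>C a *\<^sub>C (x :: 'a::complex_banach)"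
  by (simp add: scaleC_scaleC mult.commute)

lemma bounded_clinear_linear: "bounded_clinear f \<Longrightarrow> bounded_linear f"
  and bounded_clinear_scaleC: "bounded_clinear f \<Longrightarrow> f (c *\<^sub>C x) = c *\<^sub>C f x"
  by (auto simp: bounded_clinear_def)

lemma bounded_clinear_compose:
  "bounded_clinear f \<Longrightarrow> bounded_clinear g \<Longrightarrow> bounded_clinear (\<lambda>x. f (g x))"
  by (auto simp: bounded_clinear_def intro: bounded_linear_compose)

lemma bounded_clinear_add:
  "bounded_clinear f \<Longrightarrow> bounded_clinear g \<Longrightarrow> bounded_clinear (\<lambda>x. f x + g x)"
  by (auto simp: bounded_clinear_def scaleC_add_right intro: bounded_linear_add)

lemma bounded_clinear_diff:
  "bounded_clinear f \<Longrightarrow> bounded_clinear g \<Longrightarrow> bounded_clinear (\<lambda>x. f x - g x)"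
  by (auto simp: bounded_clinear_def scaleC.diff_right intro: bounded_linear_sub)

lemma bounded_clinear_const_scaleC: "bounded_clinear f \<Longrightarrow> bounded_clinear (\<lambda>x. c *\<^sub>C f x)"
  by (auto simp: bounded_clinear_def scaleC_left_commute
      intro: bounded_linear_compose[OF scaleC.bounded_linear_right])

lemma bounded_clinear_ident: "bounded_clinear (\<lambda>x. x)"
  by (auto simp: bounded_clinear_def bounded_linear_ident)

lemma bounded_clinearI:
  assumes "\<And>x y. f (x + y) = f x + f y" "\<And>c x. f (c *\<^sub>C x) = c *\<^sub>C f x"
    and "\<And>x. norm (f x) \<le> K * norm x"
  shows "bounded_clinear f"
  unfolding bounded_clinear_def
proof
  show "bounded_linear f"
  proof (rule bounded_linear_intro)
    show "f (r *\<^sub>R x) = r *\<^sub>R f x" for r x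
      using assms(2)[of "complex_of_real r" x] by (simp add: scaleC_of_real)
    show "norm (f x) \<le> norm x * K" for x
      using assms(3)[of x] by (simp add: mult.commute)
  qed (rule assms)
qed (use assms in auto)

text \<open>Only continuity into the small space is asked, and the derivative enters as a relation
  within \<open>J\<close>, so that solutions can be restricted, glued and compared freely. The
  initial value is taken in the small space, where the estimates measure it.\<close>

definition solves_on ::
    "real set \<Rightarrow> ('b::complex_banach \<Rightarrow> 'a::complex_banach) \<Rightarrow> ('b \<Rightarrow> 'a)
      \<Rightarrow> (real \<Rightarrow> 'a) \<Rightarrow> 'b \<Rightarrow> (real \<Rightarrow> 'b) \<Rightarrow> bool" where
  "solves_on J j A f x u \<longleftrightarrow> continuous_on J u \<and>
     (\<forall>t\<in>J. ((\<lambda>t. j (u t)) has_vector_derivative A (u t) + f t) (at t within J)) \<and> u 0 = x"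

lemma solves_on_subset: "solves_on J j A f x u \<Longrightarrow> K \<subseteq> J \<Longrightarrow> solves_on K j A f x u"
  unfolding solves_on_def
  by (blast intro: continuous_on_subset has_vector_derivative_within_subset)

lemma solves_on_cong:
  assumes "solves_on J j A f x u"
    and "\<And>t. t \<in> J \<Longrightarrow> B (u t) + g t = A (u t) + f t"
  shows "solves_on J j B g x u"
  using assms unfolding solves_on_def by simp

lemma solves_on_lincomb:
  assumes j: "bounded_clinear j" and A: "bounded_clinear A"
    and "solves_on J j A f x u" "solves_on J j A g y v"
  shows "solves_on J j A (\<lambda>t. f t + c *\<^sub>C g t) (x + c *\<^sub>C y) (\<lambda>t. u t + c *\<^sub>C v t)"
proof -
  interpret j: bounded_linear j by (rule bounded_clinear_linear[OF j])
  interpret A: bounded_linear A by (rule bounded_clinear_linear[OF A])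
  show ?thesis
    using assms(3,4) unfolding solves_on_def
    by (auto intro!: continuous_intros scaleC.continuous_on derivative_eq_intros
        bounded_linear.has_vector_derivative[OF scaleC.bounded_linear_right]
        simp: j.add A.add bounded_clinear_scaleC[OF j] bounded_clinear_scaleC[OF A]
          scaleC_add_right)
qed

lemma solves_on_diff:
  assumes "bounded_clinear j" "bounded_clinear A"
    and "solves_on J j A f x u" "solves_on J j A g y v"
  shows "solves_on J j A (\<lambda>t. f t - g t) (x - y) (\<lambda>t. u t - v t)"
  using solves_on_lincomb[OF assms, of "-1"] by simp

text \<open>Product rule: differentiating the factor \<open>exp (t *\<^sub>R (-\<mu>))\<close>
  contributes exactly the extra term of the shifted operator.\<close>

lemma solves_on_exp:
  fixes \<mu> :: complex
  assumes j: "bounded_clinear j" and A: "bounded_clinear A" and u: "solves_on J j A f x u"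
  shows "solves_on J j (\<lambda>y. A y - \<mu> *\<^sub>C j y) (\<lambda>t. exp (t *\<^sub>R (-\<mu>)) *\<^sub>C f t) x
           (\<lambda>t. exp (t *\<^sub>R (-\<mu>)) *\<^sub>C u t)"
proof -
  have "((\<lambda>t. exp (t *\<^sub>R (-\<mu>)) *\<^sub>C j (u t)) has_vector_derivative
        exp (t *\<^sub>R (-\<mu>)) *\<^sub>C (A (u t) + f t) + (exp (t *\<^sub>R (-\<mu>)) * (-\<mu>)) *\<^sub>C j (u t))
        (at t within J)" if "t \<in> J" for t
    by (rule scaleC.has_vector_derivative[OF exp_scaleR_has_vector_derivative_right])
      (use u that in \<open>auto simp: solves_on_def\<close>)
  then show ?thesis
    using u unfolding solves_on_def
    by (auto intro!: scaleC.continuous_on continuous_intros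
        simp: bounded_clinear_scaleC[OF j] bounded_clinear_scaleC[OF A] scaleC_add_right
          scaleC_scaleC mult.commute algebra_simps)
qed

lemma solves_on_rescale:
  assumes u: "solves_on J j A f x u" and K: "(\<lambda>t. r * t) ` K \<subseteq> J"
  shows "solves_on K j (\<lambda>y. r *\<^sub>R A y) (\<lambda>t. r *\<^sub>R f (r * t)) x (\<lambda>t. u (r * t))"
  unfolding solves_on_def
proof (intro conjI ballI)
  show "continuous_on K (\<lambda>t. u (r * t))"
  proof (rule continuous_on_compose2[OF _ _ K])
    show "continuous_on J u" using u by (simp add: solves_on_def)
    show "continuous_on K (\<lambda>t. r * t)" by (intro continuous_intros)
  qed
  show "u (r * 0) = x" using u by (simp add: solves_on_def)
  fix t assume t: "t \<in> K"
  have "((\<lambda>t. j (u t)) has_vector_derivative A (u (r * t)) + f (r * t))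
          (at (r * t) within (\<lambda>t. r * t) ` K)"
    using u K t has_vector_derivative_within_subset unfolding solves_on_def by blast
  moreover have "((\<lambda>t. r * t) has_vector_derivative r) (at t within K)"
    by (auto intro!: derivative_eq_intros simp: has_real_derivative_iff_has_vector_derivative[symmetric])
  ultimately show "((\<lambda>t. j (u (r * t))) has_vector_derivative
      r *\<^sub>R A (u (r * t)) + r *\<^sub>R f (r * t)) (at t within K)"
    using vector_diff_chain_within[of "\<lambda>t. r * t" r t K "\<lambda>t. j (u t)"]
    unfolding scaleR_add_right[symmetric] by (simp add: o_def)
qed

lemma solves_on_shift:
  assumes u: "solves_on J j A f x u" and K: "(\<lambda>t. t + a) ` K \<subseteq> J"
  shows "solves_on K j A (\<lambda>t. f (t + a)) (u a) (\<lambda>t. u (t + a))"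
  unfolding solves_on_def
proof (intro conjI ballI)
  show "continuous_on K (\<lambda>t. u (t + a))"
  proof (rule continuous_on_compose2[OF _ _ K])
    show "continuous_on J u" using u by (simp add: solves_on_def)
    show "continuous_on K (\<lambda>t. t + a)" by (intro continuous_intros)
  qed
  show "u (0 + a) = u a" by simp
  fix t assume t: "t \<in> K"
  have "((\<lambda>t. j (u t)) has_vector_derivative A (u (t + a)) + f (t + a))
          (at (t + a) within (\<lambda>t. t + a) ` K)"
    using u K t has_vector_derivative_within_subset unfolding solves_on_def by blast
  moreover have "((\<lambda>t. t + a) has_vector_derivative 1) (at t within K)"
    by (auto intro!: derivative_eq_intros)
  ultimately show "((\<lambda>t. j (u (t + a))) has_vector_derivative
      A (u (t + a)) + f (t + a)) (at t within K)"
    using vector_diff_chain_within[of "\<lambda>t. t + a" 1 t K "\<lambda>t. j (u t)"]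
    by (simp add: o_def)
qed

lemma has_vector_derivative_shift_right:
  fixes g :: "real \<Rightarrow> 'a::real_normed_vector"
  assumes "(g has_vector_derivative D) (at (t - a) within K)" "L = (\<lambda>s. s + a) ` K"
  shows "((\<lambda>t. g (t - a)) has_vector_derivative D) (at t within L)"
proof -
  have "(\<lambda>t. t - a) ` L = K"
    by (auto simp: assms(2) image_image)
  moreover have "((\<lambda>t. t - a) has_vector_derivative 1) (at t within L)"
    by (auto intro!: derivative_eq_intros)
  ultimately show ?thesis
    using vector_diff_chain_within[of "\<lambda>t. t - a" 1 t L g D] assms(1)
    by (simp add: o_def)
qed

text \<open>Both pieces have the one-sided derivative \<open>A (u a) + f a\<close> at
  \<open>a\<close>, because \<open>p\<close> starts at \<open>u a\<close>; hence the glued function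
  is differentiable across the junction. A general \<open>K\<close> covers compact intervals as well
  as the half line.\<close>

lemma solves_on_concat:
  assumes a: "0 \<le> a" and K: "closed K" "K \<subseteq> {0..}" "0 \<in> K"
    and u: "solves_on {0..a} j A f x u" and p: "solves_on K j A (\<lambda>t. f (t + a)) (u a) p"
  shows "solves_on ({0..a} \<union> (\<lambda>t. t + a) ` K) j A f x (\<lambda>t. if t \<le> a then u t else p (t - a))"
    (is "solves_on ?L j A f x ?w")
proof -
  let ?K = "(\<lambda>t. t + a) ` K"
  have cl: "closed ?K" using K(1) closed_translation[of K a] by (simp add: add.commute)
  have int: "{0..a} \<inter> ?K = {a}" using K a by force
  have p0: "p 0 = u a" using p by (simp add: solves_on_def)
  have w: "?w t = (if t \<in> {0..a} then u t else p (t - a))" if "t \<in> ?L" for t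
    using that K a by auto
  show ?thesis
    unfolding solves_on_def
  proof (intro conjI ballI)
    have "continuous_on ?L (\<lambda>t. if t \<in> {0..a} then u t else p (t - a))"
    proof (rule continuous_on_cases)
      show "continuous_on {0..a} u" using u by (simp add: solves_on_def)
      show "continuous_on ?K (\<lambda>t. p (t - a))"
      proof (rule continuous_on_compose2[of K p])
        show "continuous_on K p" using p by (simp add: solves_on_def)
        show "continuous_on ?K (\<lambda>t. t - a)" by (intro continuous_intros)
        show "(\<lambda>t. t - a) ` ?K \<subseteq> K" by auto
      qed
      show "\<forall>t. t \<in> {0..a} \<and> t \<notin> {0..a} \<or> t \<in> ?K \<and> t \<in> {0..a} \<longrightarrow> u t = p (t - a)"
      proof (intro allI impI)
        fix t assume "t \<in> {0..a} \<and> t \<notin> {0..a} \<or> t \<in> ?K \<and> t \<in> {0..a}"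
        then have "t \<in> {0..a} \<inter> ?K" by blast
        then have "t = a" unfolding int by simp
        then show "u t = p (t - a)" using p0 by simp
      qed
    qed (use cl in simp_all)
    then show "continuous_on ?L ?w"
      by (rule continuous_on_eq) (simp only: w)
    show "?w 0 = x" using u a by (simp add: solves_on_def)
    fix t assume t: "t \<in> ?L"
    have 1: "((\<lambda>t. j (u t)) has_vector_derivative A (u t) + f t) (at t within {0..a})"
      if "t \<in> {0..a}"
      using u that by (auto simp: solves_on_def)
    have 2: "((\<lambda>t. j (p (t - a))) has_vector_derivative A (p (t - a)) + f t) (at t within ?K)"
      if "t \<in> ?K"
    proof (rule has_vector_derivative_shift_right[of "\<lambda>t. j (p t)" _ _ _ K, OF _ refl])
      show "((\<lambda>t. j (p t)) has_vector_derivative A (p (t - a)) + f t) (at (t - a) within K)"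
        using p that unfolding solves_on_def by force
    qed
    have "((\<lambda>t. if t \<in> {0..a} then j (u t) else j (p (t - a))) has_vector_derivative
       (if t \<in> {0..a} then A (u t) + f t else A (p (t - a)) + f t)) (at t within ?L)"
    proof (rule has_vector_derivative_If_within_closures[OF t refl])
      have S: "{0..a} \<union> (closure {0..a} \<inter> closure ?K) = {0..a}"
        and T: "?K \<union> (closure {0..a} \<inter> closure ?K) = ?K"
        using cl by (auto simp only: closure_closed closed_atLeastAtMost)
      show "((\<lambda>t. j (u t)) has_vector_derivative A (u t) + f t)
          (at t within {0..a} \<union> (closure {0..a} \<inter> closure ?K))"
        if "t \<in> {0..a} \<union> (closure {0..a} \<inter> closure ?K)"
        using 1 that unfolding S by blast
      show "((\<lambda>t. j (p (t - a))) has_vector_derivative A (p (t - a)) + f t)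
          (at t within ?K \<union> (closure {0..a} \<inter> closure ?K))"
        if "t \<in> ?K \<union> (closure {0..a} \<inter> closure ?K)"
        using 2 that unfolding T by blast
      have "t = a" if "t \<in> closure {0..a}" "t \<in> closure ?K"
        using that cl int by (metis IntI closed_atLeastAtMost closure_closed singletonD)
      then show "j (u t) = j (p (t - a))" "A (u t) + f t = A (p (t - a)) + f t"
        if "t \<in> closure {0..a}" "t \<in> closure ?K"
        using that p0 by auto
    qed
    moreover have "(if t \<in> {0..a} then A (u t) + f t else A (p (t - a)) + f t) = A (?w t) + f t"
      unfolding w[OF t] by (simp del: atLeastAtMost_iff)
    ultimately have "((\<lambda>t. if t \<in> {0..a} then j (u t) else j (p (t - a))) has_vector_derivative
       A (?w t) + f t) (at t within ?L)"
      by argo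
    moreover have "j (?w s) = (if s \<in> {0..a} then j (u s) else j (p (s - a)))" if "s \<in> ?L" for s
      unfolding w[OF that] by (simp del: atLeastAtMost_iff)
    ultimately show "((\<lambda>t. j (?w t)) has_vector_derivative A (?w t) + f t) (at t within ?L)"
      by (rule has_vector_derivative_transform[OF t, rotated])
  qed
qed

section \<open>From maximal regularity to causal estimates\<close>

lemma BUC_Icc: "continuous_on {a..b} f \<Longrightarrow> f \<in> BUC {a..b}"
  by (simp add: BUC_def compact_uniformly_continuous compact_imp_bounded
      compact_continuous_image)

lemma BUC_const: "(\<lambda>_. c) \<in> BUC J"
  by (auto simp: BUC_def uniformly_continuous_on_const bounded_iff)

lemma BUC_cong: "u \<in> BUC J \<Longrightarrow> (\<And>t. t \<in> J \<Longrightarrow> v t = u t) \<Longrightarrow> v \<in> BUC J"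
  by (auto simp: BUC_def uniformly_continuous_on_def cong: image_cong)

lemma BUC_add:
  assumes "u \<in> BUC J" "v \<in> BUC J" shows "(\<lambda>t. u t + v t) \<in> BUC J"
proof -
  obtain a b where "\<And>t. t \<in> J \<Longrightarrow> norm (u t) \<le> a" "\<And>t. t \<in> J \<Longrightarrow> norm (v t) \<le> b"
    using assms unfolding BUC_def bounded_iff by blast
  then have "norm (u t + v t) \<le> a + b" if "t \<in> J" for t
    by (meson add_mono norm_triangle_ineq order_trans that)
  then have "bounded ((\<lambda>t. u t + v t) ` J)"
    unfolding bounded_iff by blast
  then show ?thesis
    using assms by (simp add: BUC_def uniformly_continuous_on_add)
qed

lemma BUC_bounded_linear:
  assumes "bounded_linear L" "u \<in> BUC J" shows "(\<lambda>t. L (u t)) \<in> BUC J"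
  using assms bounded_linear_image[of "u ` J" L]
  by (simp add: BUC_def bounded_linear.uniformly_continuous_on image_image)

lemma BUC_compose:
  assumes "u \<in> BUC J" "uniformly_continuous_on K g" "g ` K \<subseteq> J"
  shows "(\<lambda>t. u (g t)) \<in> BUC K"
proof -
  have "uniformly_continuous_on (g ` K) u"
    unfolding uniformly_continuous_on_def
  proof (intro allI impI)
    fix e :: real assume "0 < e"
    then obtain d where "0 < d" "\<forall>x\<in>J. \<forall>y\<in>J. dist y x < d \<longrightarrow> dist (u y) (u x) < e"
      using assms(1) unfolding BUC_def uniformly_continuous_on_def by auto
    then show "\<exists>d>0. \<forall>x\<in>g ` K. \<forall>y\<in>g ` K. dist y x < d \<longrightarrow> dist (u y) (u x) < e"
      using assms(3) by (meson subsetD)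
  qed
  moreover have "bounded ((\<lambda>t. u (g t)) ` K)"
    using assms bounded_subset[of "u ` J" "(\<lambda>t. u (g t)) ` K"] by (auto simp: BUC_def)
  ultimately show ?thesis
    using uniformly_continuous_on_compose[OF assms(2)] by (simp add: BUC_def)
qed

text \<open>Composing with the first clamp extends a function constantly beyond \<open>a\<close>;
  composing with the second delays it by \<open>a\<close>.\<close>

lemma uniformly_continuous_on_min: "uniformly_continuous_on S (\<lambda>t::real. min t a)"
  and uniformly_continuous_on_max_diff: "uniformly_continuous_on S (\<lambda>t::real. max (t - a) 0)"
  unfolding uniformly_continuous_on_def dist_real_def
  by (smt (verit))+

text \<open>What the compact interval and the half line have in common. \<open>nontrivial\<close>
  makes derivatives within \<open>J\<close> unique, so that \<open>deriv_on\<close> can be computed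
  from a known derivative.\<close>

locale time_interval =
  fixes J :: "real set"
  assumes closed: "closed J" and nonneg: "J \<subseteq> {0..}" and zero: "0 \<in> J"
    and nontrivial: "\<And>t. t \<in> J \<Longrightarrow> at t within J \<noteq> bot"
    and down: "\<And>s t. t \<in> J \<Longrightarrow> 0 \<le> s \<Longrightarrow> s \<le> t \<Longrightarrow> s \<in> J"
begin

text \<open>The equation itself shows that the derivative is bounded and uniformly continuous, since
  it equals \<open>A (u t) + f t\<close>.\<close>

lemma solves_on_imp_solves_cauchy:
  assumes j: "bounded_linear j" and A: "bounded_linear A"
    and s: "solves_on J j A f x u" and u: "u \<in> BUC J" and f: "f \<in> BUC J"
  shows "solves_cauchy J j A f (j x) u"
proof -
  have d: "((j \<circ> u) has_vector_derivative A (u t) + f t) (at t within J)" if "t \<in> J" for t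
    using s that by (simp add: solves_on_def o_def)
  then have e: "deriv_on J (j \<circ> u) t = A (u t) + f t" if "t \<in> J" for t
    unfolding deriv_on_def using that by (intro vector_derivative_within nontrivial)
  have "deriv_on J (j \<circ> u) \<in> BUC J"
    by (rule BUC_cong[OF BUC_add[OF BUC_bounded_linear[OF A u] f]]) (rule e)
  moreover have "j \<circ> u \<in> BUC J"
    using BUC_bounded_linear[OF j u] by (simp add: o_def)
  ultimately show ?thesis
    using d e u s
    by (auto simp: solves_cauchy_def EE1_def BUC1_def solves_on_def intro: differentiableI_vector)
qed

lemma solves_cauchy_imp_solves_on:
  assumes "inj j" and s: "solves_cauchy J j A f (j x) u"
  shows "solves_on J j A f x u"
  unfolding solves_on_def
proof (intro conjI ballI)
  show "continuous_on J u"
    using s by (auto simp: solves_cauchy_def EE1_def BUC_def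
        intro: uniformly_continuous_imp_continuous)
  show "u 0 = x"
    using s \<open>inj j\<close> by (simp add: solves_cauchy_def inj_eq)
  fix t assume t: "t \<in> J"
  then have "((j \<circ> u) has_vector_derivative deriv_on J (j \<circ> u) t) (at t within J)"
    using s unfolding solves_cauchy_def EE1_def BUC1_def deriv_on_def
    by (auto simp: vector_derivative_works[symmetric])
  moreover have "deriv_on J (j \<circ> u) t = A (u t) + f t"
    using s t by (auto simp: solves_cauchy_def algebra_simps)
  ultimately show "((\<lambda>t. j (u t)) has_vector_derivative A (u t) + f t) (at t within J)"
    by (simp add: o_def)
qed

lemma norm_le_EE1_norm:
  assumes "u \<in> EE1 J j" "t \<in> J" shows "norm (u t) \<le> EE1_norm J j u"
proof -
  have "deriv_on J (j \<circ> u) \<in> BUC J" "u \<in> BUC J"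
    using assms by (auto simp: EE1_def BUC1_def)
  then obtain a b where "\<And>t. t \<in> J \<Longrightarrow> norm (deriv_on J (j \<circ> u) t) \<le> a"
      "\<And>t. t \<in> J \<Longrightarrow> norm (u t) \<le> b"
    unfolding BUC_def bounded_iff by blast
  then have "bdd_above ((\<lambda>t. norm (deriv_on J (j \<circ> u) t) + norm (u t)) ` J)"
    by (intro bdd_aboveI2[where M = "a + b"]) (simp add: add_mono)
  from cSUP_upper[OF assms(2) this] show ?thesis
    unfolding EE1_norm_def using norm_ge_zero[of "deriv_on J (j \<circ> u) t"] by linarith
qed

lemma EE1_norm_nonneg: "u \<in> EE1 J j \<Longrightarrow> 0 \<le> EE1_norm J j u"
  using norm_le_EE1_norm[of u j 0] zero norm_ge_zero[of "u 0"] by linarith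

lemma deriv_on_const: "t \<in> J \<Longrightarrow> deriv_on J (\<lambda>_. c) t = 0"
  unfolding deriv_on_def by (intro vector_derivative_within nontrivial) auto

lemma const_in_EE1: "(\<lambda>_. x) \<in> EE1 J j"
proof -
  have "deriv_on J (\<lambda>_. j x) \<in> BUC J"
    by (rule BUC_cong[OF BUC_const[of 0]]) (simp add: deriv_on_const)
  then show ?thesis
    by (simp add: EE1_def BUC1_def BUC_const o_def)
qed

lemma trace_space_eq: "trace_space J j = range j"
  using const_in_EE1 by (fastforce simp: trace_space_def)

text \<open>The constant function \<open>x\<close> competes in the infimum, and its norm is
  \<open>norm x\<close> since its derivative vanishes.\<close>

lemma trace_norm_le:
  "trace_norm J (j :: 'b::complex_banach \<Rightarrow> 'a::complex_banach) (j x) \<le> norm x"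
proof -
  have "EE1_norm J j (\<lambda>_. x) = norm x"
  proof -
    have "EE1_norm J j (\<lambda>_. x) = (SUP t\<in>J. norm x)"
      unfolding EE1_norm_def o_def by (rule SUP_cong) (simp_all add: deriv_on_const)
    also have "\<dots> = norm x" using zero by (intro cSUP_const) auto
    finally show ?thesis .
  qed
  then have "norm x \<in> {EE1_norm J j u | u. u \<in> EE1 J j \<and> j (u 0) = j x}"
    using const_in_EE1 by (metis (mono_tags, lifting) mem_Collect_eq)
  moreover have "bdd_below {EE1_norm J j u | u. u \<in> EE1 J j \<and> j (u 0) = j x}"
    using EE1_norm_nonneg by (intro bdd_belowI[where m = 0]) blast
  ultimately show ?thesis
    unfolding trace_norm_def by (rule cInf_lower)
qed

lemma trace_norm_nonneg: "0 \<le> trace_norm J j (j x)"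
  unfolding trace_norm_def
proof (rule cInf_greatest)
  show "{EE1_norm J j u |u. u \<in> EE1 J j \<and> j (u 0) = j x} \<noteq> {}"
    using const_in_EE1 by blast
qed (use EE1_norm_nonneg in blast)

lemma sup_norm_on_le: "(\<And>t. t \<in> J \<Longrightarrow> norm (f t) \<le> B) \<Longrightarrow> sup_norm_on J f \<le> B"
  unfolding sup_norm_on_def using zero by (intro cSUP_least) auto

end

lemma time_interval_cases:
  assumes "(\<exists>T>0. J = {0..T}) \<or> J = {0..}" shows "time_interval J"
proof
  show "at t within J \<noteq> bot" if "t \<in> J" for t
  proof -
    obtain a b where ab: "a < b" "t \<in> {a..b}" "{a..b} \<subseteq> J"
    proof (cases "J = {0..}")
      case True
      then show ?thesis using that[of 0 "t + 1"] \<open>t \<in> J\<close> by auto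
    next
      case False
      then show ?thesis using assms that \<open>t \<in> J\<close> by blast
    qed
    then have "t islimpt {a..b}" by (simp add: islimpt_Icc)
    then show ?thesis
      using ab(3) by (metis islimpt_subset trivial_limit_within)
  qed
qed (use assms in auto)

text \<open>The estimate concerns the endpoint and sees \<open>f\<close> only up to that time.
  Applied to the difference of two solutions it gives uniqueness at \<open>T\<close>. The constants
  are kept apart because rescaling time changes \<open>C\<close> but not \<open>N\<close>.\<close>

definition regular_upto ::
    "real \<Rightarrow> ('b::complex_banach \<Rightarrow> 'a::complex_banach) \<Rightarrow> ('b \<Rightarrow> 'a) \<Rightarrow> real \<Rightarrow> real \<Rightarrow> bool" where
  "regular_upto T j A C N \<longleftrightarrow>
     (\<forall>f x. continuous_on {0..T} f \<longrightarrow> (\<exists>u. solves_on {0..T} j A f x u)) \<and>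
     (\<forall>f x u B. continuous_on {0..T} f \<longrightarrow> solves_on {0..T} j A f x u \<longrightarrow>
        (\<forall>t\<in>{0..T}. norm (f t) \<le> B) \<longrightarrow> norm (u T) \<le> C * B + N * norm x)"

lemma regular_uptoD:
  assumes "regular_upto T j A C N" "continuous_on {0..T} f"
  shows "\<exists>u. solves_on {0..T} j A f x u"
    and "solves_on {0..T} j A f x u \<Longrightarrow> (\<And>t. t \<in> {0..T} \<Longrightarrow> norm (f t) \<le> B)
      \<Longrightarrow> norm (u T) \<le> C * B + N * norm x"
  using assms unfolding regular_upto_def by blast+

text \<open>A solution on [0, T] is continued by the solution with constant forcing
  \<open>f T\<close> starting from \<open>u T\<close>. The result solves the problem on all of
  \<open>J\<close> with a forcing still bounded by \<open>B\<close>, so the estimate on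
  \<open>J\<close> bounds \<open>u T\<close> by data on [0, T], with a constant independent of
  \<open>T\<close>.\<close>

lemma maximal_regularity_imp_regular_upto:
  fixes j :: "'b::complex_banach \<Rightarrow> 'a::complex_banach"
  assumes "time_interval J" and j: "bounded_linear j" "inj j" and A: "bounded_linear A"
    and max_reg: "maximal_regularity J j A"
  obtains C where "C \<ge> 1" "\<And>T. T \<in> J \<Longrightarrow> 0 < T \<Longrightarrow> regular_upto T j A C C"
proof -
  interpret time_interval J by fact
  obtain C0 where C0: "\<And>f x u. f \<in> BUC J \<Longrightarrow> x \<in> trace_space J j \<Longrightarrow> solves_cauchy J j A f x u \<Longrightarrow>
      EE1_norm J j u \<le> C0 * (sup_norm_on J f + trace_norm J j x)"
    using max_reg unfolding maximal_regularity_def by blast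
  \<comment> \<open>\<open>C0\<close> may be negative; the maximum makes multiplication by the
    constant monotone.\<close>
  define C where "C = max C0 1"
  have ex: "\<exists>u. solves_cauchy J j A f (j x) u" if "f \<in> BUC J" for f x
    using max_reg that trace_space_eq unfolding maximal_regularity_def by blast
  have est: "norm (u t) \<le> C * B + C * norm x"
    if "solves_cauchy J j A f (j x) u" "f \<in> BUC J" "\<And>t. t \<in> J \<Longrightarrow> norm (f t) \<le> B" "t \<in> J"
    for f x u B t
  proof -
    let ?s = "sup_norm_on J f + trace_norm J j (j x)"
    have le: "norm (u t) \<le> EE1_norm J j u"
      using that by (intro norm_le_EE1_norm) (auto simp: solves_cauchy_def)
    also have le': "\<dots> \<le> C0 * ?s"
      using that by (intro C0) (auto simp: trace_space_eq)
    finally have 1: "norm (u t) \<le> C0 * ?s" .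
    have 2: "?s \<le> B + norm x"
      using sup_norm_on_le[of f B] trace_norm_le[of j x] that by (simp add: add_mono)
    have "norm (f t) \<le> sup_norm_on J f"
      unfolding sup_norm_on_def
      using that by (intro cSUP_upper bdd_aboveI2[where M = B]) auto
    then have 3: "0 \<le> ?s"
      using norm_ge_zero[of "f t"] trace_norm_nonneg[of j x] by linarith
    have "C0 * ?s \<le> C * ?s"
      by (rule mult_right_mono[OF _ 3]) (simp add: C_def)
    also have "\<dots> \<le> C * (B + norm x)"
      by (rule mult_left_mono[OF 2]) (simp add: C_def)
    finally have "C0 * ?s \<le> C * (B + norm x)" .
    with 1 show ?thesis by (simp add: algebra_simps)
  qed
  show thesis
  proof (rule that)
    show "C \<ge> 1" by (simp add: C_def)
    fix T assume T: "T \<in> J" "0 < T"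
    have JT: "{0..T} \<subseteq> J" using down[OF T(1)] by auto
    have ext: "(\<lambda>t. f (min t T)) \<in> BUC J" if "continuous_on {0..T} f" for f :: "real \<Rightarrow> 'a"
      using T nonneg
      by (intro BUC_compose[OF BUC_Icc[OF that] uniformly_continuous_on_min]) auto
    show "regular_upto T j A C C"
      unfolding regular_upto_def
    proof (intro conjI allI impI)
      fix f :: "real \<Rightarrow> 'a" and x :: 'b assume "continuous_on {0..T} f"
      then obtain u where "solves_cauchy J j A (\<lambda>t. f (min t T)) (j x) u"
        using ex[OF ext] by blast
      then have "solves_on {0..T} j A (\<lambda>t. f (min t T)) x u"
        by (rule solves_on_subset[OF solves_cauchy_imp_solves_on[OF j(2)] JT])
      then have "solves_on {0..T} j A f x u"
        by (rule solves_on_cong) auto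
      then show "\<exists>u. solves_on {0..T} j A f x u" by (rule exI[where x = u])
    next
      fix f :: "real \<Rightarrow> 'a" and x :: 'b and u B
      assume f: "continuous_on {0..T} f" and u: "solves_on {0..T} j A f x u"
        and B: "\<forall>t\<in>{0..T}. norm (f t) \<le> B"
      let ?f = "\<lambda>t. f (min t T)"
      obtain p where p: "solves_cauchy J j A (\<lambda>_. f T) (j (u T)) p"
        using ex[OF BUC_const, of "f T" "u T"] by auto
      then have p': "solves_on J j A (\<lambda>_. f T) (u T) p"
        by (rule solves_cauchy_imp_solves_on[OF j(2)])
      then have p0: "p 0 = u T" by (simp add: solves_on_def)
      define w where "w t = (if t \<le> T then u t else p (t - T))" for t
      have "solves_on ({0..T} \<union> (\<lambda>t. t + T) ` J) j A ?f x w"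
        unfolding w_def
      proof (rule solves_on_concat)
        show "solves_on {0..T} j A ?f x u"
          by (rule solves_on_cong[OF u]) auto
        show "solves_on J j A (\<lambda>t. f (min (t + T) T)) (u T) p"
          by (rule solves_on_cong[OF p']) (use nonneg in \<open>auto simp: min_def\<close>)
      qed (use T closed nonneg zero in auto)
      moreover have "J \<subseteq> {0..T} \<union> (\<lambda>t. t + T) ` J"
      proof
        fix t assume t: "t \<in> J"
        show "t \<in> {0..T} \<union> (\<lambda>t. t + T) ` J"
        proof (cases "t \<le> T")
          case True then show ?thesis using t nonneg by auto
        next
          case False
          then have "t - T \<in> J" using down[OF t] T by simp
          then have "t \<in> (\<lambda>t. t + T) ` J" by (intro image_eqI[of _ _ "t - T"]) auto
          then show ?thesis ..
        qed
      qed
      ultimately have w: "solves_on J j A ?f x w"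
        by (rule solves_on_subset)
      \<comment> \<open>Up to time \<open>T\<close> the clamped \<open>p\<close> rests at
        \<open>p 0 = u T\<close>, afterwards the clamped \<open>u\<close> rests at
        \<open>u T\<close>; subtracting \<open>u T\<close> once from their sum leaves the glued
        function.\<close>
      have "w \<in> BUC J"
      proof (rule BUC_cong)
        have "u \<in> BUC {0..T}" using u by (intro BUC_Icc) (simp add: solves_on_def)
        moreover have "p \<in> BUC J" using p by (simp add: solves_cauchy_def EE1_def)
        moreover have "max (t - T) 0 \<in> J" if "t \<in> J" for t
          using down[OF that] zero T by (cases "t \<le> T") (auto simp: max_def)
        moreover have "(\<lambda>t. min t T) ` J \<subseteq> {0..T}" using nonneg T by auto
        ultimately have "(\<lambda>t. u (min t T)) \<in> BUC J" "(\<lambda>t. p (max (t - T) 0)) \<in> BUC J"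
          using BUC_compose[OF _ uniformly_continuous_on_min, where u = u and J = "{0..T}"]
            BUC_compose[OF _ uniformly_continuous_on_max_diff, where u = p and J = J] by blast+
        then show "(\<lambda>t. u (min t T) + (p (max (t - T) 0) + (- u T))) \<in> BUC J"
          by (intro BUC_add BUC_const)
        show "w t = u (min t T) + (p (max (t - T) 0) + (- u T))" if "t \<in> J" for t
          using p0 by (auto simp: w_def min_def max_def)
      qed
      then have "solves_cauchy J j A ?f (j x) w"
        using w ext[OF f] by (intro solves_on_imp_solves_cauchy[OF j(1) A])
      then have "norm (w T) \<le> C * B + C * norm x"
      proof (rule est[OF _ ext[OF f] _ T(1)])
        show "norm (f (min t T)) \<le> B" if "t \<in> J" for t
          using B that nonneg T by auto
      qed
      then show "norm (u T) \<le> C * B + C * norm x" by (simp add: w_def)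
    qed
  qed
qed

section \<open>Uniform regularity under scaling, shifts and perturbation\<close>

definition regular ::
    "('b::complex_banach \<Rightarrow> 'a::complex_banach) \<Rightarrow> ('b \<Rightarrow> 'a) \<Rightarrow> real \<Rightarrow> real \<Rightarrow> bool" where
  "regular j A C N \<longleftrightarrow> (\<forall>T>0. regular_upto T j A C N)"

lemma regularD:
  assumes "regular j A C N" "0 < T" "continuous_on {0..T} f"
  shows regular_ex: "\<exists>u. solves_on {0..T} j A f x u"
    and regular_est: "solves_on {0..T} j A f x u \<Longrightarrow> (\<And>t. t \<in> {0..T} \<Longrightarrow> norm (f t) \<le> B)
      \<Longrightarrow> norm (u T) \<le> C * B + N * norm x"
  using assms regular_uptoD[of T j A C N f] unfolding regular_def by auto

text \<open>Stretching time moves the problem to [0, r T] with forcing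
  \<open>f (t / r) /\<^sub>R r\<close>. The factor 1/r ends up in \<open>C\<close>, while the
  initial value is untouched.\<close>

lemma regular_rescale:
  fixes j :: "'b::complex_banach \<Rightarrow> 'a::complex_banach"
  assumes reg: "regular j A C N" and r: "0 < r"
  shows "regular j (\<lambda>y. r *\<^sub>R A y) (C / r) N"
  unfolding regular_def regular_upto_def
proof (intro allI impI conjI)
  fix T :: real and f :: "real \<Rightarrow> 'a" and x assume T: "0 < T" and f: "continuous_on {0..T} f"
  have rT: "0 < r * T" using r T by simp
  have "continuous_on {0..r * T} (\<lambda>t. f (t / r) /\<^sub>R r)"
    using r by (intro continuous_intros continuous_on_compose2[OF f]) (auto simp: field_simps)
  note f' = this
  have img: "(\<lambda>t. r * t) ` {0..T} \<subseteq> {0..r * T}" using r by auto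
  {
    obtain u where "solves_on {0..r * T} j A (\<lambda>t. f (t / r) /\<^sub>R r) x u"
      using regular_ex[OF reg rT f'] by blast
    then have "solves_on {0..T} j (\<lambda>y. r *\<^sub>R A y) f x (\<lambda>t. u (r * t))"
      using solves_on_rescale[OF _ img, where f = "\<lambda>t. f (t / r) /\<^sub>R r"] r by simp
    then show "\<exists>u. solves_on {0..T} j (\<lambda>y. r *\<^sub>R A y) f x u" by blast
  next
    fix u B assume u: "solves_on {0..T} j (\<lambda>y. r *\<^sub>R A y) f x u"
      and B: "\<forall>t\<in>{0..T}. norm (f t) \<le> B"
    have "(\<lambda>t. (1 / r) * t) ` {0..r * T} \<subseteq> {0..T}" using r by (auto simp: field_simps)
    from solves_on_rescale[OF u this]
    have "solves_on {0..r * T} j A (\<lambda>t. f (t / r) /\<^sub>R r) x (\<lambda>t. u (t / r))"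
      using r by (simp add: field_simps)
    then have "norm (u (r * T / r)) \<le> C * (B / r) + N * norm x"
    proof (rule regular_est[OF reg rT f'])
      fix t assume "t \<in> {0..r * T}"
      then have "norm (f (t / r)) \<le> B" using r B by (auto simp: field_simps)
      then show "norm (f (t / r) /\<^sub>R r) \<le> B / r" using r by (simp add: field_simps)
    qed
    then show "norm (u T) \<le> C / r * B + N * norm x" using r by simp
  }
qed

text \<open>Gluing pieces of length \<open>T0\<close> would let the constants grow geometrically. A
  large shift halves the influence of the initial value over each piece, so that one bound survives
  any number of pieces.\<close>

lemma regular_upto_imp_regular_shifted:
  fixes j :: "'b::complex_banach \<Rightarrow> 'a::complex_banach"
  assumes j: "bounded_clinear j" and A: "bounded_clinear A" and T0: "0 < T0" and C: "1 \<le> C"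
    and reg: "\<And>T. 0 < T \<Longrightarrow> T \<le> T0 \<Longrightarrow> regular_upto T j A C C"
  obtains \<omega> :: real where
    "regular j (\<lambda>y. A y - complex_of_real \<omega> *\<^sub>C j y) (C + 2 * C * C) C"
proof -
  \<comment> \<open>Chosen so that \<open>exp (- (\<omega> * T0)) * C\<close> equals 1/2.\<close>
  define \<omega> where "\<omega> = ln (2 * C) / T0"
  have \<omega>: "exp (- (\<omega> * T0)) * C \<le> 1 / 2" "0 \<le> \<omega>"
    using T0 C by (auto simp: \<omega>_def exp_minus field_simps)
  define B where "B = (\<lambda>y. A y - complex_of_real \<omega> *\<^sub>C j y)"
  have Bc: "bounded_clinear B"
    unfolding B_def by (intro bounded_clinear_diff bounded_clinear_const_scaleC A j)
  have exA: "\<exists>u. solves_on {0..(1 + real n) * T0} j A f x u"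
    if "continuous_on {0..(1 + real n) * T0} f" for n f x
    using that
  proof (induction n)
    case 0
    then show ?case using regular_uptoD(1)[OF reg[of T0]] T0 by auto
  next
    case (Suc n)
    let ?a = "(1 + real n) * T0"
    have eq: "(1 + real (Suc n)) * T0 = ?a + T0" and a: "0 \<le> ?a"
      using T0 by (auto simp: algebra_simps)
    have "continuous_on {0..?a} f"
      by (rule continuous_on_subset[OF Suc.prems[unfolded eq]]) (use T0 in auto)
    with Suc.IH obtain u where u: "solves_on {0..?a} j A f x u" by blast
    have "continuous_on {0..T0} (\<lambda>t. f (t + ?a))"
      by (rule continuous_on_compose2[OF Suc.prems[unfolded eq]])
        (use a in \<open>auto intro!: continuous_intros\<close>)
    then obtain p where p: "solves_on {0..T0} j A (\<lambda>t. f (t + ?a)) (u ?a) p"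
      using regular_uptoD(1)[OF reg[of T0]] T0 by blast
    have "{0..?a} \<union> (\<lambda>t. t + ?a) ` {0..T0} = {0..?a + T0}"
      using ivl_disj_un_two_touch(4)[OF a, of "?a + T0"] T0
      by (simp only: image_add_atLeastAtMost' add_0 add.commute[of T0])
    then show ?case
      using solves_on_concat[OF a _ _ _ u p] T0 unfolding eq by auto
  qed
  \<comment> \<open>The weight \<open>exp (\<omega> * t)\<close> turns the equation back into that
    of \<open>A\<close>, with forcing at most \<open>exp (\<omega> * T) * b\<close>. Dividing by the
    weight at time \<open>T\<close> keeps the constant \<open>C\<close> of the forcing and damps the
    initial value.\<close>
  have step: "norm (u T) \<le> C * b + C * exp (- (\<omega> * T)) * norm x"
    if T: "0 < T" "T \<le> T0" and f: "continuous_on {0..T} f" and u: "solves_on {0..T} j B f x u"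
      and b: "\<And>t. t \<in> {0..T} \<Longrightarrow> norm (f t) \<le> b" for T f u b x
  proof -
    let ?e = "\<lambda>t. exp (t *\<^sub>R (- (- complex_of_real \<omega>)))"
    have "solves_on {0..T} j (\<lambda>y. B y - (- complex_of_real \<omega>) *\<^sub>C j y) (\<lambda>t. ?e t *\<^sub>C f t) x
        (\<lambda>t. ?e t *\<^sub>C u t)"
      by (rule solves_on_exp[OF j Bc u])
    then have s: "solves_on {0..T} j A (\<lambda>t. ?e t *\<^sub>C f t) x (\<lambda>t. ?e t *\<^sub>C u t)"
      by (rule solves_on_cong) (simp add: B_def)
    have n: "norm (?e t) = exp (\<omega> * t)" for t by (simp add: norm_exp_eq_Re mult.commute)
    have b0: "0 \<le> b" using order_trans[OF norm_ge_zero b[of T]] T by simp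
    have "continuous_on {0..T} (\<lambda>t. ?e t *\<^sub>C f t)"
      by (intro scaleC.continuous_on continuous_intros f)
    note g = this
    have "norm (?e T *\<^sub>C u T) \<le> C * (exp (\<omega> * T) * b) + C * norm x"
    proof -
      have "norm (?e t *\<^sub>C f t) \<le> exp (\<omega> * T) * b" if "t \<in> {0..T}" for t
        unfolding norm_scaleC n using that \<omega> b0 b by (intro mult_mono) (auto simp: mult_left_mono)
      then show ?thesis
        by (rule regular_uptoD(2)[OF reg[OF T] g s])
    qed
    then have "exp (\<omega> * T) * norm (u T) \<le> C * (exp (\<omega> * T) * b) + C * norm x"
      unfolding norm_scaleC n .
    then have "exp (- (\<omega> * T)) * (exp (\<omega> * T) * norm (u T)) \<le>
        exp (- (\<omega> * T)) * (C * (exp (\<omega> * T) * b) + C * norm x)"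
      by (rule mult_left_mono) simp
    also have "exp (- (\<omega> * T)) * (exp (\<omega> * T) * norm (u T)) = norm (u T)"
      by (simp add: exp_minus)
    also have "exp (- (\<omega> * T)) * (C * (exp (\<omega> * T) * b) + C * norm x)
        = C * b + C * exp (- (\<omega> * T)) * norm x"
      by (simp add: exp_minus field_simps)
    finally show ?thesis .
  qed
  \<comment> \<open>The invariant is \<open>norm x \<le> M\<close> together with
    \<open>2 * C * b \<le> M\<close>: at time \<open>T0\<close> the solution is at most
    \<open>C * b + 1 / 2 * norm x\<close>, hence again at most \<open>M\<close>, and the induction
    restarts from there.\<close>
  have est: "norm (u T) \<le> C * b + C * M"
    if "0 < T" "T \<le> (1 + real n) * T0" "continuous_on {0..T} f" "solves_on {0..T} j B f x u"
      "\<And>t. t \<in> {0..T} \<Longrightarrow> norm (f t) \<le> b" "norm x \<le> M" "2 * C * b \<le> M" for T f u b x n M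
    using that
  proof (induction n arbitrary: T f x u)
    case 0
    have "C * exp (- (\<omega> * T)) * norm x \<le> C * 1 * M"
      using 0 \<omega> C by (intro mult_mono) auto
    then show ?case using step[OF 0(1) _ 0(3-5)] 0(2) by simp
  next
    case (Suc n)
    show ?case
    proof (cases "T \<le> T0")
      case True
      have "C * exp (- (\<omega> * T)) * norm x \<le> C * 1 * M"
        using Suc.prems \<omega> C by (intro mult_mono) auto
      then show ?thesis using step[OF Suc.prems(1) True Suc.prems(3-5)] by simp
    next
      case False
      have sub: "{0..T0} \<subseteq> {0..T}" using False by auto
      have "norm (u T0) \<le> C * b + C * exp (- (\<omega> * T0)) * norm x"
        using T0 sub Suc.prems by (intro step[OF _ order.refl continuous_on_subset[OF _ sub]
          solves_on_subset[OF _ sub]]) auto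
      also have "\<dots> \<le> C * b + 1 / 2 * norm x"
        using mult_right_mono[OF \<omega>(1), of "norm x"] by (simp add: mult.commute)
      also have "\<dots> \<le> M" using Suc.prems by linarith
      finally have M: "norm (u T0) \<le> M" .
      have img: "(\<lambda>t. t + T0) ` {0..T - T0} \<subseteq> {0..T}" using T0 by auto
      have "norm (u (T - T0 + T0)) \<le> C * b + C * M"
      proof (rule Suc.IH[where T = "T - T0" and f = "\<lambda>t. f (t + T0)" and x = "u T0"
            and u = "\<lambda>t. u (t + T0)", OF _ _ _ _ _ M])
        show "solves_on {0..T - T0} j B (\<lambda>t. f (t + T0)) (u T0) (\<lambda>t. u (t + T0))"
          by (rule solves_on_shift[OF Suc.prems(4) img])
        show "continuous_on {0..T - T0} (\<lambda>t. f (t + T0))"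
          by (rule continuous_on_compose2[OF Suc.prems(3) _ img]) (intro continuous_intros)
      qed (use Suc.prems False T0 img in \<open>auto simp: algebra_simps\<close>)
      then show ?thesis by simp
    qed
  qed
  show thesis
  proof (rule that[of \<omega>], unfold regular_def regular_upto_def B_def[symmetric], intro allI impI conjI)
    fix T :: real and f :: "real \<Rightarrow> 'a" and x assume T: "0 < T" and f: "continuous_on {0..T} f"
    obtain n where "T / T0 \<le> real n" using real_arch_simple by blast
    then have n: "T \<le> (1 + real n) * T0" using T0 by (simp add: field_simps)
    {
      \<comment> \<open>The forcing is weighted and extended constantly past \<open>T\<close>, so
        that existence on a multiple of \<open>T0\<close> applies; the weight is then undone and the
        solution restricted.\<close>
      let ?g = "\<lambda>t. exp (t *\<^sub>R complex_of_real \<omega>) *\<^sub>C f (min t T)"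
      have "continuous_on {0..(1 + real n) * T0} ?g"
        by (intro scaleC.continuous_on continuous_intros continuous_on_compose2[OF f])
          (use T in auto)
      then obtain u where u: "solves_on {0..(1 + real n) * T0} j A ?g x u"
        using exA by blast
      have "solves_on {0..(1 + real n) * T0} j B
          (\<lambda>t. exp (t *\<^sub>R (- complex_of_real \<omega>)) *\<^sub>C ?g t) x
          (\<lambda>t. exp (t *\<^sub>R (- complex_of_real \<omega>)) *\<^sub>C u t)"
        unfolding B_def by (rule solves_on_exp[OF j A u])
      then have "solves_on {0..T} j B
          (\<lambda>t. exp (t *\<^sub>R (- complex_of_real \<omega>)) *\<^sub>C ?g t) x
          (\<lambda>t. exp (t *\<^sub>R (- complex_of_real \<omega>)) *\<^sub>C u t)"
        by (rule solves_on_subset) (use n in auto)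
      then have "solves_on {0..T} j B f x (\<lambda>t. exp (t *\<^sub>R (- complex_of_real \<omega>)) *\<^sub>C u t)"
        by (rule solves_on_cong) (simp add: scaleC_scaleC exp_minus)
      then show "\<exists>u. solves_on {0..T} j B f x u" by blast
    next
      fix u b assume u: "solves_on {0..T} j B f x u" and b: "\<forall>t\<in>{0..T}. norm (f t) \<le> b"
      have "0 \<le> b" using order_trans[OF norm_ge_zero, of "f T" b] b T by simp
      \<comment> \<open>\<open>M = norm x + 2 * C * b\<close> meets both conditions of the
        invariant.\<close>
      then have "norm (u T) \<le> C * b + C * (norm x + 2 * C * b)"
        using b C by (intro est[OF T n f u]) auto
      then show "norm (u T) \<le> (C + 2 * C * C) * b + C * norm x"
        by (simp add: algebra_simps)
    }
  qed
qed

text \<open>Existence: sending \<open>w\<close> to the solution with forcing \<open>f + P w\<close>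
  is a contraction, because differences start at zero and \<open>C * K \<le> 1 / 2\<close>.
  Estimate: by the same inequality half of the maximum of \<open>u\<close> is absorbed, which
  doubles both constants.\<close>

lemma regular_perturb:
  fixes j :: "'b::complex_banach \<Rightarrow> 'a::complex_banach"
  assumes j: "bounded_clinear j" and A: "bounded_clinear A"
    and reg: "regular j A C N" and N: "1 \<le> N" and C: "0 \<le> C"
    and P: "bounded_clinear P" "\<And>y. norm (P y) \<le> K * norm y" and K: "0 \<le> K"
    and CK: "C * K \<le> 1 / 2"
  shows "regular j (\<lambda>y. A y + P y) (2 * C) (2 * N)"
proof -
  interpret P: bounded_linear P by (rule bounded_clinear_linear[OF P(1)])
  show ?thesis
    unfolding regular_def regular_upto_def
  proof (intro allI impI conjI)
    fix T :: real and f :: "real \<Rightarrow> 'a" and x assume T: "0 < T" and f: "continuous_on {0..T} f"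
    {
      \<comment> \<open>Clamping time to [0, T] makes the solution a bounded continuous function on
        the whole line, an element of the complete space in which the fixed point is sought.\<close>
      have "\<exists>g u. solves_on {0..T} j A (\<lambda>t. f t + P (apply_bcontfun w t)) x u \<and>
          (\<forall>t. apply_bcontfun g t = u (max 0 (min t T)))" for w
      proof -
        have "continuous_on {0..T} (\<lambda>t. f t + P (apply_bcontfun w t))"
          by (intro continuous_intros f P.continuous_on continuous_on_apply_bcontfun)
        then obtain u where u: "solves_on {0..T} j A (\<lambda>t. f t + P (apply_bcontfun w t)) x u"
          using regular_ex[OF reg T] by blast
        then have uc: "continuous_on {0..T} u" by (simp add: solves_on_def)
        have "(\<lambda>t. u (max 0 (min t T))) \<in> bcontfun"
          unfolding bcontfun_def
        proof (intro CollectI conjI)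
          show "continuous_on UNIV (\<lambda>t. u (max 0 (min t T)))"
            by (intro continuous_on_compose2[OF uc] continuous_intros) (use T in auto)
          show "bounded (range (\<lambda>t. u (max 0 (min t T))))"
            using T by (intro bounded_subset[OF compact_imp_bounded[OF
                  compact_continuous_image[OF uc compact_Icc]]]) auto
        qed
        then obtain g where "(\<lambda>t. u (max 0 (min t T))) = apply_bcontfun g"
          by (rule bcontfunE)
        then show ?thesis using u by (metis)
      qed
      then obtain \<Phi> U where
        U: "\<And>w. solves_on {0..T} j A (\<lambda>t. f t + P (apply_bcontfun w t)) x (U w)" and
        \<Phi>: "\<And>w t. apply_bcontfun (\<Phi> w) t = U w (max 0 (min t T))"
        by metis
      have "dist (\<Phi> v) (\<Phi> w) \<le> 1 / 2 * dist v w" for v w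
      proof (rule dist_bound)
        fix s
        define t where "t = max 0 (min s T)"
        have t: "0 \<le> t" "{0..t} \<subseteq> {0..T}" using T by (auto simp: t_def)
        have "norm (U v t - U w t) \<le> 1 / 2 * dist v w"
        proof (cases "t = 0")
          case True
          then show ?thesis using U unfolding solves_on_def by simp
        next
          case False
          have "solves_on {0..T} j A
              (\<lambda>t. (f t + P (apply_bcontfun v t)) - (f t + P (apply_bcontfun w t))) (x - x)
              (\<lambda>t. U v t - U w t)"
            by (rule solves_on_diff[OF j A U U])
          then have "solves_on {0..T} j A (\<lambda>t. P (apply_bcontfun v t - apply_bcontfun w t)) 0
              (\<lambda>t. U v t - U w t)"
            by (simp add: P.diff)
          \<comment> \<open>Regularity on the shorter interval [0, t] bounds the difference at every
            time \<open>t\<close>, as the supremum distance requires.\<close>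
          then have s: "solves_on {0..t} j A (\<lambda>t. P (apply_bcontfun v t - apply_bcontfun w t)) 0
              (\<lambda>t. U v t - U w t)"
            by (rule solves_on_subset[OF _ t(2)])
          have "norm (U v t - U w t) \<le> C * (K * dist v w) + N * norm (0 :: 'b)"
          proof (rule regular_est[OF reg _ _ s])
            show "0 < t" using False t by simp
            show "continuous_on {0..t} (\<lambda>t. P (apply_bcontfun v t - apply_bcontfun w t))"
              by (intro P.continuous_on continuous_intros continuous_on_apply_bcontfun)
            fix r
            have "norm (P (apply_bcontfun v r - apply_bcontfun w r))
                \<le> K * norm (apply_bcontfun v r - apply_bcontfun w r)" by (rule P(2))
            also have "\<dots> \<le> K * dist v w"
              using dist_bounded[of v r w] K by (simp add: dist_norm mult_left_mono)
            finally show "norm (P (apply_bcontfun v r - apply_bcontfun w r)) \<le> K * dist v w" .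
          qed
          also have "\<dots> \<le> 1 / 2 * dist v w"
            using mult_right_mono[OF CK, of "dist v w"] by (simp add: mult.assoc)
          finally show ?thesis .
        qed
        then show "dist (apply_bcontfun (\<Phi> v) s) (apply_bcontfun (\<Phi> w) s) \<le> 1 / 2 * dist v w"
          by (simp add: \<Phi> t_def dist_norm)
      qed
      then obtain w where w: "\<Phi> w = w"
        using banach_fix_type[of "1 / 2" \<Phi>] by auto
      have "apply_bcontfun w t = U w t" if "t \<in> {0..T}" for t
        using \<Phi>[of w t] that by (simp add: w max_def min_def)
      then have "solves_on {0..T} j (\<lambda>y. A y + P y) f x (U w)"
        by (intro solves_on_cong[OF U]) (simp add: algebra_simps)
      then show "\<exists>u. solves_on {0..T} j (\<lambda>y. A y + P y) f x u" by blast
    next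
      fix u B assume u: "solves_on {0..T} j (\<lambda>y. A y + P y) f x u"
        and B: "\<forall>t\<in>{0..T}. norm (f t) \<le> B"
      have uc: "continuous_on {0..T} u" using u by (simp add: solves_on_def)
      have "continuous_on {0..T} (\<lambda>t. norm (u t))" using uc by (intro continuous_intros)
      \<comment> \<open>At a time of maximal norm the forcing \<open>f + P u\<close> is bounded by
        \<open>B + K * norm (u t)\<close>, so the estimate at that same time can absorb the
        perturbation.\<close>
      then obtain t where t: "t \<in> {0..T}" "\<And>s. s \<in> {0..T} \<Longrightarrow> norm (u s) \<le> norm (u t)"
        using continuous_attains_sup[OF compact_Icc, of 0 T "\<lambda>t. norm (u t)"] T by force
      have B0: "0 \<le> B" using order_trans[OF norm_ge_zero, of "f T" B] B T by simp
      have "norm (u t) \<le> 2 * C * B + 2 * N * norm x"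
      proof (cases "t = 0")
        case True
        then have "norm (u t) = norm x" using u by (simp add: solves_on_def)
        moreover have "1 * norm x \<le> 2 * N * norm x" using N by (intro mult_right_mono) auto
        moreover have "0 \<le> 2 * C * B" using C B0 by simp
        ultimately show ?thesis by (simp only: mult_1)
      next
        case False
        have sub: "{0..t} \<subseteq> {0..T}" and t0: "0 < t" using t False by auto
        have "solves_on {0..T} j A (\<lambda>t. f t + P (u t)) x u"
          by (rule solves_on_cong[OF u]) simp
        then have s: "solves_on {0..t} j A (\<lambda>t. f t + P (u t)) x u"
          by (rule solves_on_subset[OF _ sub])
        have "norm (u t) \<le> C * (B + K * norm (u t)) + N * norm x"
        proof (rule regular_est[OF reg t0 _ s])
          show "continuous_on {0..t} (\<lambda>t. f t + P (u t))"
            by (intro continuous_intros P.continuous_on continuous_on_subset[OF f sub]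
                continuous_on_subset[OF uc sub])
          fix s assume "s \<in> {0..t}"
          then have s: "s \<in> {0..T}" using sub by blast
          have "norm (f s + P (u s)) \<le> norm (f s) + norm (P (u s))" by (rule norm_triangle_ineq)
          also have "\<dots> \<le> B + K * norm (u t)"
            using B s P(2)[of "u s"] mult_left_mono[OF t(2)[OF s] K] by (meson add_mono order_trans)
          finally show "norm (f s + P (u s)) \<le> B + K * norm (u t)" .
        qed
        also have "\<dots> \<le> C * B + 1 / 2 * norm (u t) + N * norm x"
          using mult_right_mono[OF CK, of "norm (u t)"] by (simp add: algebra_simps)
        finally show ?thesis by simp
      qed
      then show "norm (u T) \<le> 2 * C * B + 2 * N * norm x"
        using t(2)[of T] T by auto
    }
  qed
qed

section \<open>The resolvent\<close>

lemma bounded_clinear_shifted: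
  "bounded_clinear j \<Longrightarrow> bounded_clinear A \<Longrightarrow> bounded_clinear (\<lambda>y. A y - \<mu> *\<^sub>C j y)"
  by (intro bounded_clinear_diff bounded_clinear_const_scaleC)

lemma solves_on_exp_shifted:
  assumes j: "bounded_clinear j" and A: "bounded_clinear A"
    and u: "solves_on J j (\<lambda>y. A y - \<mu> *\<^sub>C j y) f x u"
  shows "solves_on J j A (\<lambda>t. exp (t *\<^sub>R \<mu>) *\<^sub>C f t) x (\<lambda>t. exp (t *\<^sub>R \<mu>) *\<^sub>C u t)"
  using solves_on_cong[OF solves_on_exp[OF j bounded_clinear_shifted[OF j A] u, of "- \<mu>"]]
  by (simp add: algebra_simps)

lemma norm_exp_scaleR: "norm (exp (t *\<^sub>R \<mu>)) = exp (t * Re \<mu>)" for \<mu> :: complex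
  by (simp add: norm_exp_eq_Re)

text \<open>By this time the growth of \<open>exp (t *\<^sub>R \<mu>)\<close> outweighs the constant
  \<open>N\<close> twice over, so that the contribution of the initial value is at most one
  half.\<close>

lemma resolvent_time:
  assumes "1 \<le> N" "0 < Re \<mu>"
  obtains T where "0 < T" "2 * N \<le> exp (T * Re \<mu>)"
proof
  show "0 < ln (2 * N) / Re \<mu>" using assms by (intro divide_pos_pos ln_gt_zero) auto
  show "2 * N \<le> exp (ln (2 * N) / Re \<mu> * Re \<mu>)" using assms by simp
qed

text \<open>The function \<open>exp (t *\<^sub>R \<mu>) *\<^sub>C x\<close> solves the equation of
  \<open>A\<close> with forcing \<open>exp (t *\<^sub>R \<mu>) *\<^sub>C ?y\<close>. At a late time
  the term \<open>N * norm x\<close> is absorbed and the weight \<open>?E\<close> cancels, so the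
  bound depends neither on that time nor on \<open>\<mu>\<close>.\<close>

lemma regular_resolvent_est:
  assumes j: "bounded_clinear j" and A: "bounded_clinear A"
    and reg: "regular j A C N" and N: "1 \<le> N" and C: "0 \<le> C" and \<mu>: "0 < Re \<mu>"
  shows "norm x \<le> 2 * C * norm (\<mu> *\<^sub>C j x - A x)"
proof -
  obtain T where T: "0 < T" "2 * N \<le> exp (T * Re \<mu>)"
    using resolvent_time[OF N \<mu>] .
  let ?y = "\<mu> *\<^sub>C j x - A x" and ?E = "exp (T * Re \<mu>)"
  have "solves_on {0..T} j (\<lambda>y. A y - \<mu> *\<^sub>C j y) (\<lambda>_. ?y) x (\<lambda>_. x)"
    by (simp add: solves_on_def)
  then have s: "solves_on {0..T} j A (\<lambda>t. exp (t *\<^sub>R \<mu>) *\<^sub>C ?y) x (\<lambda>t. exp (t *\<^sub>R \<mu>) *\<^sub>C x)"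
    by (rule solves_on_exp_shifted[OF j A])
  have "norm (exp (T *\<^sub>R \<mu>) *\<^sub>C x) \<le> C * (?E * norm ?y) + N * norm x"
  proof (rule regular_est[OF reg T(1) _ s])
    show "continuous_on {0..T} (\<lambda>t. exp (t *\<^sub>R \<mu>) *\<^sub>C ?y)"
      by (intro scaleC.continuous_on continuous_intros)
    show "norm (exp (t *\<^sub>R \<mu>) *\<^sub>C ?y) \<le> ?E * norm ?y" if "t \<in> {0..T}" for t
      unfolding norm_scaleC norm_exp_scaleR using that \<mu> by (intro mult_right_mono) auto
  qed
  also have "N * norm x \<le> ?E / 2 * norm x"
    using T(2) by (intro mult_right_mono) auto
  finally have "?E * norm x \<le> ?E * (2 * C * norm ?y)"
    unfolding norm_scaleC norm_exp_scaleR by (simp add: field_simps)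
  then show ?thesis by simp
qed

text \<open>A periodic solution of the shifted equation with constant forcing \<open>y\<close> has
  mean derivative zero, so its mean value is a preimage of \<open>y\<close>.\<close>

lemma regular_resolvent_ex:
  fixes j :: "'b::complex_banach \<Rightarrow> 'a::complex_banach"
  assumes j: "bounded_clinear j" and A: "bounded_clinear A"
    and reg: "regular j A C N" and N: "1 \<le> N" and \<mu>: "0 < Re \<mu>"
  shows "\<exists>x. \<mu> *\<^sub>C j x - A x = y"
proof -
  obtain T where T: "0 < T" "2 * N \<le> exp (T * Re \<mu>)"
    using resolvent_time[OF N \<mu>] .
  let ?B = "\<lambda>y. A y - \<mu> *\<^sub>C j y"
  have B: "bounded_clinear ?B" by (rule bounded_clinear_shifted[OF j A])
  have "\<exists>v. solves_on {0..T} j ?B (\<lambda>_. y) x v" for x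
  proof -
    have "continuous_on {0..T} (\<lambda>t. exp (t *\<^sub>R \<mu>) *\<^sub>C y)"
      by (intro scaleC.continuous_on continuous_intros)
    then obtain u where "solves_on {0..T} j A (\<lambda>t. exp (t *\<^sub>R \<mu>) *\<^sub>C y) x u"
      using regular_ex[OF reg T(1)] by blast
    from solves_on_exp[OF j A this, of \<mu>] show ?thesis
      by (auto simp: scaleC_scaleC exp_minus)
  qed
  then obtain V where V: "\<And>x. solves_on {0..T} j ?B (\<lambda>_. y) x (V x)" by metis
  \<comment> \<open>Weighted by \<open>exp (t *\<^sub>R \<mu>)\<close>, a difference of solutions
    obeys the homogeneous equation of \<open>A\<close> and grows at most by the factor
    \<open>N\<close>; removing the weight at \<open>T\<close> leaves at most 1/2. The fixed point is
    the initial value of a periodic solution.\<close>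
  have "dist (V x T) (V x' T) \<le> 1 / 2 * dist x x'" for x x'
  proof -
    have "solves_on {0..T} j ?B (\<lambda>_. 0) (x - x') (\<lambda>t. V x t - V x' t)"
      using solves_on_diff[OF j B V V] by simp
    from solves_on_exp_shifted[OF j A this]
    have s: "solves_on {0..T} j A (\<lambda>_. 0) (x - x') (\<lambda>t. exp (t *\<^sub>R \<mu>) *\<^sub>C (V x t - V x' t))"
      by simp
    have "norm (exp (T *\<^sub>R \<mu>) *\<^sub>C (V x T - V x' T)) \<le> C * 0 + N * norm (x - x')"
      by (rule regular_est[OF reg T(1) _ s]) auto
    also have "\<dots> \<le> exp (T * Re \<mu>) / 2 * norm (x - x')"
      using T(2) mult_right_mono[of N "exp (T * Re \<mu>) / 2" "norm (x - x')"] by simp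
    finally have "exp (T * Re \<mu>) * norm (V x T - V x' T) \<le> exp (T * Re \<mu>) * (1 / 2 * norm (x - x'))"
      unfolding norm_scaleC norm_exp_scaleR by simp
    then show ?thesis by (simp add: dist_norm)
  qed
  then obtain x where x: "V x T = x"
    using banach_fix_type[of "1 / 2" "\<lambda>x. V x T"] by auto
  define v where "v = V x"
  have v: "solves_on {0..T} j ?B (\<lambda>_. y) x v" unfolding v_def by (rule V)
  have "((\<lambda>t. ?B (v t) + y) has_integral (j (v T) - j (v 0))) {0..T}"
    using v T by (intro fundamental_theorem_of_calculus) (auto simp: solves_on_def)
  moreover have "v T = v 0" using v x by (simp add: solves_on_def v_def)
  ultimately have 1: "((\<lambda>t. ?B (v t) + y) has_integral 0) {0..T}" by simp
  have "continuous_on {0..T} v" using v by (simp add: solves_on_def)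
  \<comment> \<open>The integral is taken in the small space, where \<open>v\<close> is continuous,
    so that the bounded operator \<open>?B\<close> can be pulled out of it.\<close>
  then obtain I where I: "(v has_integral I) {0..T}"
    using integrable_continuous_real[of 0 T v] unfolding integrable_on_def by blast
  have "((\<lambda>t. ?B (v t)) has_integral ?B I) {0..T}"
    using has_integral_linear[OF I bounded_clinear_linear[OF B]] by (simp add: o_def)
  moreover have "((\<lambda>t. y) has_integral T *\<^sub>R y) {0..T}"
    using has_integral_const_real[of y 0 T] T by simp
  ultimately have "((\<lambda>t. ?B (v t) + y) has_integral ?B I + T *\<^sub>R y) {0..T}"
    by (rule has_integral_add)
  with 1 have "?B I + T *\<^sub>R y = 0" by (rule has_integral_unique[symmetric])
  then have e: "T *\<^sub>R y = - ?B I" by (simp add: add_eq_0_iff2 add_eq_0_iff)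
  interpret B: bounded_linear ?B by (rule bounded_clinear_linear[OF B])
  have "\<mu> *\<^sub>C j (I /\<^sub>R T) - A (I /\<^sub>R T) = - ?B (I /\<^sub>R T)" by simp
  also have "\<dots> = (- ?B I) /\<^sub>R T" using B.scaleR[of "inverse T" I] by (simp only: scaleR_minus_right)
  also have "\<dots> = y" unfolding e[symmetric] using T by simp
  finally show ?thesis by blast
qed

lemma regular_resolvent_bij:
  assumes "bounded_clinear j" "bounded_clinear A"
    and "regular j A C N" "1 \<le> N" "0 \<le> C" "0 < Re \<mu>"
  shows "bij (\<lambda>x. \<mu> *\<^sub>C j x - A x)"
proof (rule bijI)
  let ?G = "\<lambda>x. \<mu> *\<^sub>C j x - A x"
  have "bounded_linear ?G"
    by (intro bounded_clinear_linear bounded_clinear_diff bounded_clinear_const_scaleC assms)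
  then have lin: "linear ?G" by (rule bounded_linear.linear)
  show "inj ?G"
    unfolding linear_inj_iff_eq_0[OF lin]
    using regular_resolvent_est[OF assms] by (metis mult_zero_right norm_le_zero_iff norm_zero)
  show "surj ?G"
    unfolding surj_def using regular_resolvent_ex[OF assms(1-4,6)] by metis
qed

lemma regular_resolvent_inv:
  assumes "bounded_clinear j" "bounded_clinear A"
    and "regular j A C N" "1 \<le> N" "0 \<le> C" "0 < Re \<mu>"
  shows "bounded_clinear (inv (\<lambda>x. \<mu> *\<^sub>C j x - A x))"
proof (rule bounded_clinearI)
  let ?G = "\<lambda>x. \<mu> *\<^sub>C j x - A x"
  have bij: "bij ?G" by (rule regular_resolvent_bij[OF assms])
  have G: "bounded_clinear ?G"
    by (intro bounded_clinear_diff bounded_clinear_const_scaleC assms)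
  interpret G: bounded_linear ?G by (rule bounded_clinear_linear[OF G])
  have GR: "?G (inv ?G y) = y" for y
    using surj_f_inv_f[OF bij_is_surj[OF bij], of y] .
  have RG: "inv ?G (?G x) = x" for x
    using inv_f_f[OF bij_is_inj[OF bij], of x] .
  show "inv ?G (y + z) = inv ?G y + inv ?G z" for y z
    using RG[of "inv ?G y + inv ?G z"] unfolding G.add GR .
  show "inv ?G (c *\<^sub>C y) = c *\<^sub>C inv ?G y" for c y
    using RG[of "c *\<^sub>C inv ?G y"] unfolding bounded_clinear_scaleC[OF G] GR .
  show "norm (inv ?G y) \<le> 2 * C * norm y" for y
    using regular_resolvent_est[OF assms, of "inv ?G y"] unfolding GR .
qed

lemma regular_imp_resolvent_set:
  assumes j: "bounded_clinear j" "inj j" and A: "bounded_clinear A"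
    and reg: "regular j A C N" "1 \<le> N" "0 \<le> C" and \<mu>: "0 < Re \<mu>"
  shows "\<mu> \<in> resolvent_set (range j) (unbounded_op j A)"
proof -
  let ?G = "\<lambda>x. \<mu> *\<^sub>C j x - A x" and ?H = "\<lambda>x. \<mu> *\<^sub>C x - unbounded_op j A x"
  note as = j(1) A reg \<mu>
  have bij: "bij ?G" by (rule regular_resolvent_bij[OF as])
  have H: "?H (j x) = ?G x" for x by (simp add: unbounded_op_def j(2))
  have bijH: "bij_betw ?H (range j) UNIV"
  proof (rule bij_betw_imageI)
    show "inj_on ?H (range j)"
      using bij unfolding inj_on_def by (auto simp: H dest: bij_is_inj[THEN injD])
    show "?H ` range j = UNIV"
      using bij_is_surj[OF bij] by (simp add: image_image H)
  qed
  have "inv_into (range j) ?H y = j (inv ?G y)" for y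
  proof (rule inv_into_f_eq)
    show "inj_on ?H (range j)" using bijH by (rule bij_betw_imp_inj_on)
    show "?H (j (inv ?G y)) = y" 
      unfolding H using surj_f_inv_f[OF bij_is_surj[OF bij], of y] .
  qed simp
  then have "inv_into (range j) ?H = (\<lambda>y. j (inv ?G y))" by blast
  then show ?thesis
    unfolding resolvent_set_def
    using bijH bounded_clinear_compose[OF j(1) regular_resolvent_inv[OF as]] by simp
qed

text \<open>For small \<open>\<epsilon>\<close> the operator A + \<epsilon> is still uniformly
  regular, so the open right half plane lies in its resolvent set; translating back confines the
  spectrum of \<open>A\<close> to real parts at most \<open>- \<epsilon>\<close>.\<close>

lemma regular_imp_spectral_bound_neg:
  assumes j: "bounded_clinear j" "inj j" and A: "bounded_clinear A"
    and reg: "regular j A C N" and N: "1 \<le> N" and C: "0 \<le> C"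
  shows "spectral_bound (range j) (unbounded_op j A) < 0"
proof -
  obtain K where K: "\<And>x. norm (j x) \<le> norm x * K" "0 < K"
    using bounded_linear.pos_bounded[OF bounded_clinear_linear[OF j(1)]] by blast
  \<comment> \<open>\<open>C + 1\<close> keeps the denominator positive when \<open>C = 0\<close>
    and still gives \<open>C * (\<epsilon> * K) \<le> 1 / 2\<close>.\<close>
  define \<epsilon> where "\<epsilon> = 1 / (2 * (C + 1) * K)"
  have \<epsilon>: "0 < \<epsilon>" using K C by (simp add: \<epsilon>_def)
  have reg': "regular j (\<lambda>y. A y + complex_of_real \<epsilon> *\<^sub>C j y) (2 * C) (2 * N)"
  proof (rule regular_perturb[OF j(1) A reg N C])
    show "norm (complex_of_real \<epsilon> *\<^sub>C j y) \<le> \<epsilon> * K * norm y" for y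
      using K(1)[of y] \<epsilon> by (simp add: mult.assoc mult.commute mult_left_mono)
    have "\<epsilon> * K = 1 / (2 * (C + 1))" using K(2) by (simp add: \<epsilon>_def)
    then have "C * (\<epsilon> * K) = C / (2 * (C + 1))" by simp
    also have "\<dots> \<le> 1 / 2" using C by (simp add: divide_simps)
    finally show "C * (\<epsilon> * K) \<le> 1 / 2" .
  qed (use j K \<epsilon> in \<open>auto intro: bounded_clinear_const_scaleC\<close>)
  have "\<mu> \<in> resolvent_set (range j) (unbounded_op j A)" if "- \<epsilon> < Re \<mu>" for \<mu>
  proof -
    let ?A = "\<lambda>y. A y + complex_of_real \<epsilon> *\<^sub>C j y"
    have "\<mu> + complex_of_real \<epsilon> \<in> resolvent_set (range j) (unbounded_op j ?A)"
      using reg' N C that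
      by (intro regular_imp_resolvent_set[OF j bounded_clinear_add[OF A
              bounded_clinear_const_scaleC[OF j(1)]] reg']) auto
    moreover have "(\<mu> + complex_of_real \<epsilon>) *\<^sub>C x - unbounded_op j ?A x
        = \<mu> *\<^sub>C x - unbounded_op j A x" if "x \<in> range j" for x
      using that j(2) by (auto simp: unbounded_op_def scaleC_add_left)
    ultimately show ?thesis
      unfolding resolvent_set_def inv_into_def by (simp cong: bij_betw_cong conj_cong)
  qed
  then have "Re \<mu> \<le> - \<epsilon>" if "\<mu> \<in> op_spectrum (range j) (unbounded_op j A)" for \<mu>
    using that unfolding op_spectrum_def by (metis ComplD linorder_not_le)
  then have "spectral_bound (range j) (unbounded_op j A) \<le> ereal (- \<epsilon>)"
    unfolding spectral_bound_def by (intro SUP_least) simp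
  also have "\<dots> < 0" using \<epsilon> by simp
  finally show ?thesis .
qed

section \<open>Holomorphic dependence on the direction of time\<close>

text \<open>Intermediate times are endpoints of shorter intervals, and regularity covers all
  lengths; time 0 is settled by \<open>N \<ge> 1\<close>.\<close>

lemma regular_est_le:
  assumes reg: "regular j A C N" and N: "1 \<le> N" and C: "0 \<le> C" and f: "continuous_on {0..T} f"
    and u: "solves_on {0..T} j A f x u" and B: "\<And>t. t \<in> {0..T} \<Longrightarrow> norm (f t) \<le> B"
    and t: "t \<in> {0..T}"
  shows "norm (u t) \<le> C * B + N * norm x"
proof (cases "t = 0")
  case True
  have "0 \<le> B" using order_trans[OF norm_ge_zero B[OF t]] .
  then have "0 \<le> C * B" using C by simp
  moreover have "1 * norm x \<le> N * norm x" using N by (intro mult_right_mono) auto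
  ultimately show ?thesis using True u by (simp add: solves_on_def)
next
  case False
  then have sub: "{0..t} \<subseteq> {0..T}" "0 < t" using t by auto
  show ?thesis
    by (rule regular_est[OF reg sub(2) continuous_on_subset[OF f sub(1)]
          solves_on_subset[OF u sub(1)]]) (use B sub in auto)
qed

lemma regular_unique:
  assumes j: "bounded_clinear j" and A: "bounded_clinear A"
    and reg: "regular j A C N" "1 \<le> N" "0 \<le> C"
    and u: "solves_on {0..T} j A f x u" and v: "solves_on {0..T} j A f x v" and t: "t \<in> {0..T}"
  shows "u t = v t"
proof -
  have "solves_on {0..T} j A (\<lambda>_. 0) 0 (\<lambda>t. u t - v t)"
    using solves_on_diff[OF j A u v] by simp
  from regular_est_le[OF reg _ this, of 0, OF _ _ t] show ?thesis by simp
qed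

lemma bounded_clinear_lincombI:
  assumes f: "\<And>x y c. f (x + c *\<^sub>C y) = f x + c *\<^sub>C f y"
    and "\<And>x. norm (f x) \<le> K * norm x"
  shows "bounded_clinear f"
proof (rule bounded_clinearI)
  have 0: "f 0 = 0" using assms(2)[of 0] by simp
  show "f (x + y) = f x + f y" for x y using f[of x 1 y] by simp
  show "f (c *\<^sub>C x) = c *\<^sub>C f x" for c x using f[of 0 c x] by (simp add: 0)
qed (rule assms)

lemma has_derivative_quadraticI:
  fixes f :: "'a::real_normed_vector \<Rightarrow> 'b::real_normed_vector"
  assumes L: "bounded_linear L" and S: "open S" "z \<in> S"
    and q: "\<And>y. y \<in> S \<Longrightarrow> norm (f y - f z - L (y - z)) \<le> K * (norm (y - z))\<^sup>2"
  shows "(f has_derivative L) (at z)"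
  unfolding has_derivative_at_alt
proof (intro conjI allI impI L)
  fix e :: real assume e: "0 < e"
  obtain r where r: "0 < r" "ball z r \<subseteq> S" using S open_contains_ball by blast
  define d where "d = min r (e / (\<bar>K\<bar> + 1))"
  have "norm (f y - f z - L (y - z)) \<le> e * norm (y - z)" if "norm (y - z) < d" for y
  proof -
    have "y \<in> S" using that r by (auto simp: d_def mem_ball dist_norm norm_minus_commute)
    have "norm (y - z) < e / (\<bar>K\<bar> + 1)" using that by (simp add: d_def)
    then have "(\<bar>K\<bar> + 1) * norm (y - z) \<le> e" by (simp add: field_simps)
    moreover have "K * norm (y - z) \<le> (\<bar>K\<bar> + 1) * norm (y - z)"
      by (intro mult_right_mono) auto
    ultimately have "K * norm (y - z) \<le> e" by linarith
    then have "K * norm (y - z) * norm (y - z) \<le> e * norm (y - z)" by (intro mult_right_mono) auto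
    then show ?thesis using q[OF \<open>y \<in> S\<close>] by (simp add: power2_eq_square mult.assoc)
  qed
  moreover have "0 < d" using r e by (simp add: d_def)
  ultimately show "\<exists>d>0. \<forall>y. norm (y - z) < d \<longrightarrow>
      norm (f y - f z - L (y - z)) \<le> e * norm (y - z)" by blast
qed

section \<open>The sector of complex directions\<close>

locale regular_pair =
  fixes j :: "'b::complex_banach \<Rightarrow> 'a::complex_banach" and A :: "'b \<Rightarrow> 'a" and C N :: real
  assumes j: "bounded_clinear j" and inj: "inj j" and dense: "closure (range j) = UNIV"
    and A: "bounded_clinear A" and reg: "regular j A C N" and C: "1 \<le> C" and N: "1 \<le> N"
begin

sublocale j: bounded_linear j by (rule bounded_clinear_linear[OF j])
sublocale A: bounded_linear A by (rule bounded_clinear_linear[OF A])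

definition bound_A :: real where "bound_A = (SOME K. 0 < K \<and> (\<forall>x. norm (A x) \<le> K * norm x))"

lemma norm_A_le: "0 < bound_A" "norm (A x) \<le> bound_A * norm x"
proof -
  have "\<exists>K. 0 < K \<and> (\<forall>x. norm (A x) \<le> K * norm x)"
    using A.pos_bounded by (simp add: mult.commute)
  then have "0 < bound_A \<and> (\<forall>x. norm (A x) \<le> bound_A * norm x)" unfolding bound_A_def by (rule someI_ex)
  then show "0 < bound_A" "norm (A x) \<le> bound_A * norm x" by auto
qed

text \<open>The slope up to which the imaginary part is an admissible perturbation: if
  \<open>\<bar>Im \<zeta>\<bar> \<le> \<delta> * Re \<zeta>\<close>, then
  \<open>C / Re \<zeta> * (\<bar>Im \<zeta>\<bar> * bound_A)\<close> is at most 1/2.\<close>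

definition \<delta> :: real where "\<delta> = 1 / (2 * C * bound_A)"

text \<open>The open sector of half-angle \<open>arctan \<delta>\<close>; in this form openness and
  closure under sums are immediate.\<close>

definition V :: "complex set" where "V = {\<zeta>. 0 < Re \<zeta> \<and> \<bar>Im \<zeta>\<bar> < \<delta> * Re \<zeta>}"

lemma delta_pos: "0 < \<delta>" using norm_A_le C by (simp add: \<delta>_def)

lemma open_V: "open V"
  unfolding V_def by (intro open_Collect_conj open_Collect_less continuous_intros)

lemma V_add: "z \<in> V \<Longrightarrow> w \<in> V \<Longrightarrow> z + w \<in> V"
  unfolding V_def by (auto simp: algebra_simps)

lemma V_mult: "0 < r \<Longrightarrow> z \<in> V \<Longrightarrow> of_real r * z \<in> V"
  unfolding V_def by (auto simp: abs_mult mult.left_commute)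

lemma V_of_real: "0 < r \<Longrightarrow> of_real r \<in> V"
  unfolding V_def using delta_pos by simp

lemma zero_notin_V: "0 \<notin> V"
  unfolding V_def by simp

text \<open>The real part of \<open>\<zeta>\<close> acts by rescaling time, the imaginary part as a
  perturbation that is small relative to it.\<close>

lemma regular_mult:
  assumes "\<zeta> \<in> V" shows "regular j (\<lambda>y. \<zeta> *\<^sub>C A y) (2 * (C / Re \<zeta>)) (2 * N)"
proof -
  have r: "0 < Re \<zeta>" and i: "\<bar>Im \<zeta>\<bar> \<le> \<delta> * Re \<zeta>" using assms by (auto simp: V_def)
  have rA: "bounded_clinear (\<lambda>y. Re \<zeta> *\<^sub>R A y)"
    using bounded_clinear_const_scaleC[OF A, of "of_real (Re \<zeta>)"] by (simp add: scaleC_of_real)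
  have "regular j (\<lambda>y. Re \<zeta> *\<^sub>R A y + (\<i> * of_real (Im \<zeta>)) *\<^sub>C A y) (2 * (C / Re \<zeta>)) (2 * N)"
  proof (rule regular_perturb[OF j rA regular_rescale[OF reg r] N])
    show "norm ((\<i> * of_real (Im \<zeta>)) *\<^sub>C A y) \<le> (\<bar>Im \<zeta>\<bar> * bound_A) * norm y" for y
      using norm_A_le(2)[of y] by (simp add: norm_mult mult.assoc mult_left_mono)
    have "C / Re \<zeta> * (\<bar>Im \<zeta>\<bar> * bound_A) \<le> C / Re \<zeta> * ((\<delta> * Re \<zeta>) * bound_A)"
      using i r C norm_A_le by (intro mult_left_mono mult_right_mono) auto
    also have "\<dots> = 1 / 2" using r C norm_A_le by (simp add: \<delta>_def)
    finally show "C / Re \<zeta> * (\<bar>Im \<zeta>\<bar> * bound_A) \<le> 1 / 2" .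
  qed (use C norm_A_le r A in \<open>auto intro: bounded_clinear_const_scaleC\<close>)
  moreover have "Re \<zeta> *\<^sub>R y + (\<i> * of_real (Im \<zeta>)) *\<^sub>C y = \<zeta> *\<^sub>C y" for y :: 'a
    by (metis scaleC_of_real scaleC_add_left complex_eq)
  ultimately show ?thesis by simp
qed

section \<open>The solution operator on the unit interval\<close>

definition bound_reg :: "complex \<Rightarrow> real" where "bound_reg \<zeta> = 2 * (C / Re \<zeta>)"

lemma bound_reg_nonneg: "\<zeta> \<in> V \<Longrightarrow> 0 \<le> bound_reg \<zeta>" using C by (simp add: bound_reg_def V_def)

lemma clinear_mult: "bounded_clinear (\<lambda>y. \<zeta> *\<^sub>C A y)"
  by (rule bounded_clinear_const_scaleC[OF A])

text \<open>Time stays in [0, 1] and the direction is carried by \<open>\<zeta>\<close>. For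
  \<open>\<zeta>\<close> in \<open>V\<close> and continuous \<open>f\<close>, uniqueness fixes the
  chosen function on [0, 1].\<close>

definition U :: "complex \<Rightarrow> (real \<Rightarrow> 'a) \<Rightarrow> 'b \<Rightarrow> real \<Rightarrow> 'b" where
  "U \<zeta> f x = (SOME u. solves_on {0..1} j (\<lambda>y. \<zeta> *\<^sub>C A y) f x u)"

lemma U_solves:
  assumes "\<zeta> \<in> V" "continuous_on {0..1} f"
  shows "solves_on {0..1} j (\<lambda>y. \<zeta> *\<^sub>C A y) f x (U \<zeta> f x)"
  unfolding U_def using regular_ex[OF regular_mult[OF assms(1)] zero_less_one assms(2)]
  by (rule someI_ex)

lemma U_unique:
  assumes "\<zeta> \<in> V" "continuous_on {0..1} f" "solves_on {0..1} j (\<lambda>y. \<zeta> *\<^sub>C A y) f x u" "t \<in> {0..1}"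
  shows "u t = U \<zeta> f x t"
  using N bound_reg_nonneg[OF assms(1)] unfolding bound_reg_def
  by (intro regular_unique[OF j clinear_mult regular_mult[OF assms(1)] _ _ assms(3) U_solves[OF assms(1,2)] assms(4)]) auto

lemma solution_norm_le:
  assumes "\<zeta> \<in> V" "continuous_on {0..1} f" "solves_on {0..1} j (\<lambda>y. \<zeta> *\<^sub>C A y) f x u"
    "\<And>t. t \<in> {0..1} \<Longrightarrow> norm (f t) \<le> B" "t \<in> {0..1}"
  shows "norm (u t) \<le> bound_reg \<zeta> * B + 2 * N * norm x"
  using N bound_reg_nonneg[OF assms(1)] unfolding bound_reg_def
  by (intro regular_est_le[OF regular_mult[OF assms(1)] _ _ assms(2-5)]) auto

lemma continuous_U:
  assumes "\<zeta> \<in> V" "continuous_on {0..1} f" shows "continuous_on {0..1} (U \<zeta> f x)"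
  using U_solves[OF assms] by (simp add: solves_on_def)

lemma U_lincomb:
  assumes "\<zeta> \<in> V" "continuous_on {0..1} f" "continuous_on {0..1} g" "t \<in> {0..1}"
  shows "U \<zeta> (\<lambda>t. f t + b *\<^sub>C g t) (x + b *\<^sub>C y) t = U \<zeta> f x t + b *\<^sub>C U \<zeta> g y t"
  using assms
  by (intro U_unique[symmetric] solves_on_lincomb[OF j clinear_mult] U_solves
      scaleC.continuous_on continuous_intros)

section \<open>Orbits, the time-one map and its complex derivative\<close>

abbreviation orbit :: "complex \<Rightarrow> 'b \<Rightarrow> real \<Rightarrow> 'b" where "orbit \<zeta> x \<equiv> U \<zeta> (\<lambda>_. 0) x"

definition S1 :: "complex \<Rightarrow> 'b \<Rightarrow> 'b" where "S1 \<zeta> x = orbit \<zeta> x 1"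

text \<open>The formal derivative of \<open>S1 \<zeta> x\<close> in \<open>\<zeta>\<close>:
  differentiating u' = \<zeta> A u, u(0) = x gives k' = \<zeta> A k + A u with k(0) = 0.\<close>

definition D1 :: "complex \<Rightarrow> 'b \<Rightarrow> 'b" where "D1 \<zeta> x = U \<zeta> (\<lambda>t. A (orbit \<zeta> x t)) 0 1"

lemma orbit_solves: "\<zeta> \<in> V \<Longrightarrow> solves_on {0..1} j (\<lambda>y. \<zeta> *\<^sub>C A y) (\<lambda>_. 0) x (orbit \<zeta> x)"
  by (rule U_solves) auto

lemma orbit_lincomb:
  "\<zeta> \<in> V \<Longrightarrow> t \<in> {0..1} \<Longrightarrow> orbit \<zeta> (x + b *\<^sub>C y) t = orbit \<zeta> x t + b *\<^sub>C orbit \<zeta> y t"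
  using U_lincomb[of \<zeta> "\<lambda>_. 0" "\<lambda>_. 0" t b x y] by simp

lemma orbit_le: "\<zeta> \<in> V \<Longrightarrow> t \<in> {0..1} \<Longrightarrow> norm (orbit \<zeta> x t) \<le> 2 * N * norm x"
  using solution_norm_le[OF _ _ orbit_solves, of \<zeta> 0 t x] by simp

lemma orbit_0: "\<zeta> \<in> V \<Longrightarrow> orbit \<zeta> x 0 = x"
  using orbit_solves by (simp add: solves_on_def)

lemma continuous_A_orbit: "\<zeta> \<in> V \<Longrightarrow> continuous_on {0..1} (\<lambda>t. A (orbit \<zeta> x t))"
  by (intro A.continuous_on continuous_U) auto

lemma A_orbit_le:
  assumes "\<zeta> \<in> V" "t \<in> {0..1}" shows "norm (A (orbit \<zeta> x t)) \<le> bound_A * (2 * N * norm x)"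
  using norm_A_le(1) order_trans[OF norm_A_le(2) mult_left_mono[OF orbit_le[OF assms]]] by simp

lemma S1_le: "\<zeta> \<in> V \<Longrightarrow> norm (S1 \<zeta> x) \<le> 2 * N * norm x"
  unfolding S1_def by (rule orbit_le) auto

lemma clinear_S1: "\<zeta> \<in> V \<Longrightarrow> bounded_clinear (S1 \<zeta>)"
  using S1_le by (intro bounded_clinear_lincombI[where K = "2 * N"]) (auto simp: S1_def orbit_lincomb)

lemma U_cong:
  assumes "\<zeta> \<in> V" "continuous_on {0..1} g" "\<And>t. t \<in> {0..1} \<Longrightarrow> f t = g t" "t \<in> {0..1}"
  shows "U \<zeta> f x t = U \<zeta> g x t"
proof (rule U_unique[OF assms(1,2) _ assms(4)])
  have "continuous_on {0..1} f" using continuous_on_eq[OF assms(2)] assms(3) by metis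
  from solves_on_cong[OF U_solves[OF assms(1) this]]
  show "solves_on {0..1} j (\<lambda>y. \<zeta> *\<^sub>C A y) g x (U \<zeta> f x)"
    using assms(3) by simp
qed

lemma clinear_D1:
  assumes V: "\<zeta> \<in> V" shows "bounded_clinear (D1 \<zeta>)"
proof (rule bounded_clinear_lincombI)
  show "norm (D1 \<zeta> x) \<le> (bound_reg \<zeta> * (bound_A * (2 * N))) * norm x" for x
    using solution_norm_le[OF V _ U_solves[OF V], of "\<lambda>t. A (orbit \<zeta> x t)" "bound_A * (2 * N * norm x)" 1 0]
      continuous_A_orbit[OF V] A_orbit_le[OF V]
    by (simp add: D1_def mult.assoc)
  fix x y b
  have "D1 \<zeta> (x + b *\<^sub>C y)
      = U \<zeta> (\<lambda>t. A (orbit \<zeta> x t) + b *\<^sub>C A (orbit \<zeta> y t)) (0 + b *\<^sub>C 0) 1"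
    unfolding D1_def using V continuous_A_orbit[OF V]
    by (simp, intro U_cong)
      (auto intro!: scaleC.continuous_on continuous_intros
        simp: orbit_lincomb A.add bounded_clinear_scaleC[OF A])
  also have "\<dots> = D1 \<zeta> x + b *\<^sub>C D1 \<zeta> y"
    unfolding D1_def by (rule U_lincomb) (use V continuous_A_orbit in auto)
  finally show "D1 \<zeta> (x + b *\<^sub>C y) = D1 \<zeta> x + b *\<^sub>C D1 \<zeta> y" .
qed

text \<open>The difference \<open>w\<close> of the orbits solves the equation for
  \<open>\<kappa>\<close> with forcing \<open>?h *\<^sub>C A (?u t)\<close> and zero initial value,
  so it is of first order in \<open>?h\<close>. Subtracting \<open>?h\<close> times the variational
  solution leaves the forcing \<open>?h *\<^sub>C A (w t)\<close>, hence a second-order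
  remainder.\<close>

lemma S1_quadratic:
  assumes l: "\<zeta> \<in> V" and k: "\<kappa> \<in> V"
  shows "norm (S1 \<zeta> x - S1 \<kappa> x - (\<zeta> - \<kappa>) *\<^sub>C D1 \<kappa> x)
    \<le> ((bound_reg \<kappa> * bound_A)\<^sup>2 * (2 * N)) * (norm (\<zeta> - \<kappa>))\<^sup>2 * norm x"
proof -
  let ?u = "orbit \<zeta> x" and ?v = "orbit \<kappa> x" and ?h = "\<zeta> - \<kappa>"
  let ?k = "U \<kappa> (\<lambda>t. A (?v t)) 0" and ?S = "\<lambda>f. solves_on {0..1} j (\<lambda>y. \<kappa> *\<^sub>C A y) f"
  define w where "w = (\<lambda>t. ?u t - ?v t)"
  \<comment> \<open>The orbit for \<open>\<zeta>\<close> is read as a solution for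
    \<open>\<kappa>\<close>, with the difference of the operators moved into the forcing.\<close>
  have "?S (\<lambda>t. ?h *\<^sub>C A (?u t)) x ?u"
    by (rule solves_on_cong[OF orbit_solves[OF l]]) (simp add: scaleC.diff_left)
  from solves_on_diff[OF j clinear_mult this orbit_solves[OF k, of x]]
  have w: "?S (\<lambda>t. ?h *\<^sub>C A (?u t)) 0 w" by (simp add: w_def)
  have wle: "norm (w t) \<le> bound_reg \<kappa> * (norm ?h * (bound_A * (2 * N * norm x)))" if "t \<in> {0..1}" for t
    using solution_norm_le[OF k _ w _ that, of "norm ?h * (bound_A * (2 * N * norm x))"]
      continuous_A_orbit[OF l] A_orbit_le[OF l]
    by (simp add: scaleC.continuous_on mult_left_mono)
  have wc: "continuous_on {0..1} w" using w by (simp add: solves_on_def)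
  have "?S (\<lambda>t. ?h *\<^sub>C A (?u t) + (- ?h) *\<^sub>C A (?v t)) (0 + (- ?h) *\<^sub>C 0) (\<lambda>t. w t + (- ?h) *\<^sub>C ?k t)"
    by (rule solves_on_lincomb[OF j clinear_mult w U_solves[OF k continuous_A_orbit[OF k]]])
  then have z: "?S (\<lambda>t. ?h *\<^sub>C A (w t)) 0 (\<lambda>t. w t - ?h *\<^sub>C ?k t)"
    by (simp add: w_def A.diff scaleC.diff_right del: minus_diff_eq)
  have "norm (w 1 - ?h *\<^sub>C ?k 1)
      \<le> bound_reg \<kappa> * (norm ?h * (bound_A * (bound_reg \<kappa> * (norm ?h * (bound_A * (2 * N * norm x)))))) + 2 * N * norm (0::'b)"
  proof (rule solution_norm_le[OF k _ z])
    show "continuous_on {0..1} (\<lambda>t. ?h *\<^sub>C A (w t))"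
      by (intro scaleC.continuous_on continuous_intros A.continuous_on wc)
    fix t :: real assume "t \<in> {0..1}"
    then have "norm (A (w t)) \<le> bound_A * (bound_reg \<kappa> * (norm ?h * (bound_A * (2 * N * norm x))))"
      using order_trans[OF norm_A_le(2) mult_left_mono[OF wle]] norm_A_le(1) by simp
    then show "norm (?h *\<^sub>C A (w t)) \<le> norm ?h * (bound_A * (bound_reg \<kappa> * (norm ?h * (bound_A * (2 * N * norm x)))))"
      by (simp add: mult_left_mono)
  qed simp
  then show ?thesis
    by (simp add: w_def S1_def D1_def power2_eq_square mult_ac)
qed

lemma S1_has_derivative:
  assumes "\<kappa> \<in> V"
  shows "((\<lambda>\<zeta>. S1 \<zeta> x) has_derivative (\<lambda>h. h *\<^sub>C D1 \<kappa> x)) (at \<kappa>)"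
proof (rule has_derivative_quadraticI[OF scaleC.bounded_linear_left open_V assms])
  show "norm (S1 \<zeta> x - S1 \<kappa> x - (\<zeta> - \<kappa>) *\<^sub>C D1 \<kappa> x)
    \<le> (((bound_reg \<kappa> * bound_A)\<^sup>2 * (2 * N)) * norm x) * (norm (\<zeta> - \<kappa>))\<^sup>2" if "\<zeta> \<in> V" for \<zeta>
    using S1_quadratic[OF that assms, of x] by (simp add: mult_ac)
qed

lemma S1_line_derivative:
  assumes "z + of_real t * w \<in> V"
  shows "((\<lambda>t. S1 (z + of_real t * w) x) has_vector_derivative w *\<^sub>C D1 (z + of_real t * w) x)
    (at t within K)"
proof -
  have "((\<lambda>t. z + of_real t * w) has_derivative (\<lambda>h. of_real h * w)) (at t within K)"
    by (auto intro!: derivative_eq_intros)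
  from has_derivative_compose[OF this S1_has_derivative[OF assms, of x]]
  show ?thesis
    unfolding has_vector_derivative_def
    by (simp add: scaleC_scaleC[symmetric] scaleC_of_real)
qed

text \<open>Time change: running the equation for \<open>\<zeta>\<close> up to time \<open>s\<close>
  amounts to running the one for \<open>of_real s * \<zeta>\<close> up to time 1.\<close>

lemma S1_scale:
  assumes "\<zeta> \<in> V" "0 < s" "s \<le> 1"
  shows "S1 (of_real s * \<zeta>) x = orbit \<zeta> x s"
proof -
  have "(\<lambda>t. s * t) ` {0..1} \<subseteq> {0..1}" using assms by (auto intro: mult_le_one)
  from solves_on_rescale[OF orbit_solves[OF assms(1)] this, of x]
  have "solves_on {0..1} j (\<lambda>y. (of_real s * \<zeta>) *\<^sub>C A y) (\<lambda>_. 0) x (\<lambda>t. orbit \<zeta> x (s * t))"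
    by (simp add: scaleC_scaleC[symmetric] scaleC_of_real)
  from U_unique[OF V_mult[OF assms(2,1)] _ this, of 1] show ?thesis by (simp add: S1_def)
qed

text \<open>Comparing the complex derivative with the derivative along the ray through \<open>\<zeta>\<close>.\<close>

lemma j_D1:
  assumes l: "\<zeta> \<in> V" shows "j (D1 \<zeta> x) = A (S1 \<zeta> x)"
proof -
  \<comment> \<open>The interval stays away from 0, because \<open>of_real t * \<zeta>\<close> lies
    in \<open>V\<close> only for positive \<open>t\<close>.\<close>
  have sub: "{1/2..1} \<subseteq> {0..1::real}" by auto
  have "((\<lambda>t. S1 (0 + of_real t * \<zeta>) x) has_vector_derivative \<zeta> *\<^sub>C D1 (0 + of_real 1 * \<zeta>) x)
      (at 1 within {1/2..1})"
    by (rule S1_line_derivative) (use l in simp)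
  from j.has_vector_derivative[OF this]
  have 1: "((\<lambda>t. j (S1 (of_real t * \<zeta>) x)) has_vector_derivative \<zeta> *\<^sub>C j (D1 \<zeta> x))
      (at 1 within {1/2..1})"
    by (simp add: bounded_clinear_scaleC[OF j])
  have "((\<lambda>t. j (orbit \<zeta> x t)) has_vector_derivative \<zeta> *\<^sub>C A (orbit \<zeta> x 1) + 0)
      (at 1 within {0..1})"
    using orbit_solves[OF l, of x] by (auto simp: solves_on_def)
  then have "((\<lambda>t. j (orbit \<zeta> x t)) has_vector_derivative \<zeta> *\<^sub>C A (S1 \<zeta> x)) (at 1 within {1/2..1})"
    using has_vector_derivative_within_subset[OF _ sub] by (simp add: S1_def)
  then have "((\<lambda>t. j (S1 (of_real t * \<zeta>) x)) has_vector_derivative \<zeta> *\<^sub>C A (S1 \<zeta> x))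
      (at 1 within {1/2..1})"
    by (rule has_vector_derivative_transform[rotated 2]) (auto simp: S1_scale[OF l])
  with 1 have "\<zeta> *\<^sub>C j (D1 \<zeta> x) = \<zeta> *\<^sub>C A (S1 \<zeta> x)"
    by (intro vector_derivative_unique_within[of 1 "{1/2..1}"])
      (auto simp: trivial_limit_within islimpt_Icc)
  then have "inverse \<zeta> *\<^sub>C \<zeta> *\<^sub>C j (D1 \<zeta> x) = inverse \<zeta> *\<^sub>C \<zeta> *\<^sub>C A (S1 \<zeta> x)" by simp
  then show ?thesis using l zero_notin_V by (cases "\<zeta> = 0") (auto simp: scaleC_scaleC)
qed

text \<open>Along the segment from \<open>z\<close> to \<open>z + w\<close>, the curve
  \<open>S1 (z + of_real t * w) x\<close> solves the equation for \<open>w\<close> with initial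
  value \<open>S1 z x\<close>, by \<open>j_D1\<close>; uniqueness identifies its value at time
  1.\<close>

lemma S1_add:
  assumes z: "z \<in> V" and w: "w \<in> V" shows "S1 (z + w) x = S1 w (S1 z x)"
proof -
  have V: "z + of_real t * w \<in> V" if "t \<in> {0..1}" for t
    using V_add[OF z V_mult[OF _ w], of t] z that by (cases "t = 0") auto
  have d: "((\<lambda>t. S1 (z + of_real t * w) x) has_vector_derivative w *\<^sub>C D1 (z + of_real t * w) x)
    (at t within {0..1})" if "t \<in> {0..1}" for t
    by (rule S1_line_derivative[OF V[OF that]])
  have "solves_on {0..1} j (\<lambda>y. w *\<^sub>C A y) (\<lambda>_. 0) (S1 z x) (\<lambda>t. S1 (z + of_real t * w) x)"
    unfolding solves_on_def
  proof (intro conjI ballI)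
    show "continuous_on {0..1} (\<lambda>t. S1 (z + of_real t * w) x)"
      using d has_vector_derivative_continuous continuous_on_eq_continuous_within by blast
    show "((\<lambda>t. j (S1 (z + of_real t * w) x)) has_vector_derivative
        w *\<^sub>C A (S1 (z + of_real t * w) x) + 0) (at t within {0..1})" if "t \<in> {0..1}" for t
      using j.has_vector_derivative[OF d[OF that]]
      by (simp add: bounded_clinear_scaleC[OF j] j_D1[OF V[OF that]])
  qed simp
  from U_unique[OF w _ this, of 1] show ?thesis by (simp add: S1_def)
qed

end

section \<open>The analytic semigroup on the large space\<close>

context regular_pair
begin

section \<open>The isomorphism 1 - A and the transported semigroup\<close>

definition G :: "'b \<Rightarrow> 'a" where "G x = 1 *\<^sub>C j x - A x"

definition R :: "'a \<Rightarrow> 'b" where "R = inv G"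

lemma G_eq: "G = (\<lambda>x. 1 *\<^sub>C j x - A x)"
  by (rule ext) (rule G_def)

lemma clinear_G: "bounded_clinear G"
  unfolding G_eq by (intro bounded_clinear_diff bounded_clinear_const_scaleC j A)

lemma bij_G: "bij G"
  unfolding G_eq using C by (intro regular_resolvent_bij[OF j A reg N]) auto

lemma clinear_R: "bounded_clinear R"
  unfolding R_def G_eq using C by (intro regular_resolvent_inv[OF j A reg N]) auto

sublocale G: bounded_linear G by (rule bounded_clinear_linear[OF clinear_G])
sublocale R: bounded_linear R by (rule bounded_clinear_linear[OF clinear_R])

lemma GR [simp]: "G (R y) = y"
  unfolding R_def by (rule surj_f_inv_f[OF bij_is_surj[OF bij_G]])

lemma RG [simp]: "R (G x) = x"
  unfolding R_def by (rule inv_f_f[OF bij_is_inj[OF bij_G]])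

text \<open>Conjugation by the isomorphism \<open>G\<close> turns a bounded operator on the small
  space into one on the large space. The value at 0 is set separately since 0 lies outside
  \<open>V\<close>.\<close>

definition S :: "complex \<Rightarrow> 'a \<Rightarrow>\<^sub>L 'a" where
  "S \<zeta> = (if \<zeta> = 0 then id_blinfun else Blinfun (\<lambda>y. G (S1 \<zeta> (R y))))"

lemma S_0: "S 0 = id_blinfun" by (simp add: S_def)

lemma clinear_GS1R: "\<zeta> \<in> V \<Longrightarrow> bounded_clinear (\<lambda>y. G (S1 \<zeta> (R y)))"
  by (intro bounded_clinear_compose[OF clinear_G] bounded_clinear_compose[OF clinear_S1] clinear_R)

lemma S_apply: "\<zeta> \<in> V \<Longrightarrow> blinfun_apply (S \<zeta>) y = G (S1 \<zeta> (R y))"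
  using zero_notin_V by (auto simp: S_def bounded_linear_Blinfun_apply bounded_clinear_linear clinear_GS1R)

lemma clinear_S: "\<zeta> \<in> V \<Longrightarrow> bounded_clinear (blinfun_apply (S \<zeta>))"
  using ext[of "blinfun_apply (S \<zeta>)", OF S_apply] clinear_GS1R by metis

lemma S_add: "z \<in> V \<Longrightarrow> w \<in> V \<Longrightarrow> S (z + w) = S z o\<^sub>L S w"
  by (rule blinfun_eqI) (simp add: S_apply V_add S1_add[of w z, unfolded add.commute[of w z]])

text \<open>Placed between the bounded maps \<open>G\<close> and \<open>R\<close>, the quadratic
  remainder of \<open>S1\<close> is bounded by a multiple of \<open>norm y\<close>, which gives
  differentiability in the operator norm.\<close>

lemma S_differentiable:
  assumes k: "\<kappa> \<in> V" shows "complex_differentiable_op S \<kappa>"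
proof -
  define D where "D = Blinfun (\<lambda>y. G (D1 \<kappa> (R y)))"
  define L where "L h = Blinfun (\<lambda>y. h *\<^sub>C G (D1 \<kappa> (R y)))" for h
  have clD: "bounded_clinear (\<lambda>y. G (D1 \<kappa> (R y)))"
    by (intro bounded_clinear_compose[OF clinear_G] bounded_clinear_compose[OF clinear_D1[OF k]] clinear_R)
  have D: "blinfun_apply D y = G (D1 \<kappa> (R y))" for y
    unfolding D_def by (simp add: bounded_linear_Blinfun_apply bounded_clinear_linear[OF clD])
  have L: "blinfun_apply (L h) y = h *\<^sub>C G (D1 \<kappa> (R y))" for h y
    unfolding L_def
    by (simp add: bounded_linear_Blinfun_apply
        bounded_clinear_linear[OF bounded_clinear_const_scaleC[OF clD]])
  obtain g where g: "\<And>x. norm (G x) \<le> norm x * g" "0 < g" using G.pos_bounded by blast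
  obtain \<rho> where \<rho>: "\<And>y. norm (R y) \<le> norm y * \<rho>" "0 < \<rho>" using R.pos_bounded by blast
  let ?K = "(bound_reg \<kappa> * bound_A)\<^sup>2 * (2 * N)"
  have K: "0 \<le> ?K" using N by simp
  have "bounded_linear L"
  proof (rule bounded_linear_intro)
    show "L (x + y) = L x + L y" for x y
      by (rule blinfun_eqI) (simp add: L blinfun.add_left scaleC_add_left)
    show "L (r *\<^sub>R x) = r *\<^sub>R L x" for r x
      by (rule blinfun_eqI) (simp add: L blinfun.scaleR_left scaleC.scaleR_left)
    show "norm (L x) \<le> norm x * norm D" for x
    proof (rule norm_blinfun_bound)
      show "norm (blinfun_apply (L x) y) \<le> norm x * norm D * norm y" for y
        using mult_left_mono[OF norm_blinfun[of D y], of "norm x"] by (simp add: L D mult.assoc)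
    qed simp
  qed
  moreover have "norm (S \<zeta> - S \<kappa> - L (\<zeta> - \<kappa>)) \<le> (?K * \<rho> * g) * (norm (\<zeta> - \<kappa>))\<^sup>2"
    if z: "\<zeta> \<in> V" for \<zeta>
  proof (rule norm_blinfun_bound)
    show "0 \<le> (?K * \<rho> * g) * (norm (\<zeta> - \<kappa>))\<^sup>2"
      using K less_imp_le[OF g(2)] less_imp_le[OF \<rho>(2)]
      by (meson mult_nonneg_nonneg zero_le_power2)
    fix y
    let ?d = "S1 \<zeta> (R y) - S1 \<kappa> (R y) - (\<zeta> - \<kappa>) *\<^sub>C D1 \<kappa> (R y)"
    let ?b = "?K * (norm (\<zeta> - \<kappa>))\<^sup>2"
    have eq: "blinfun_apply (S \<zeta> - S \<kappa> - L (\<zeta> - \<kappa>)) y = G ?d"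
      by (simp add: blinfun.diff_left S_apply z k L G.diff bounded_clinear_scaleC[OF clinear_G])
    have "norm ?d \<le> ?b * (norm y * \<rho>)"
    proof (rule order_trans[OF S1_quadratic[OF z k]])
      show "?b * norm (R y) \<le> ?b * (norm y * \<rho>)"
        by (rule mult_left_mono[OF \<rho>(1) mult_nonneg_nonneg[OF K zero_le_power2]])
    qed
    then have "norm (G ?d) \<le> ?b * (norm y * \<rho>) * g"
      by (rule order_trans[OF g(1) mult_right_mono[OF _ less_imp_le[OF g(2)]]])
    then show "norm (blinfun_apply (S \<zeta> - S \<kappa> - L (\<zeta> - \<kappa>)) y)
        \<le> (?K * \<rho> * g) * (norm (\<zeta> - \<kappa>))\<^sup>2 * norm y"
      unfolding eq by (simp only: mult_ac)
  qed
  ultimately have "(S has_derivative L) (at \<kappa>)"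
    by (intro has_derivative_quadraticI[OF _ open_V k])
  then show ?thesis
    unfolding complex_differentiable_op_def using L D by (intro exI[of _ L] exI[of _ D]) simp
qed

lemma S_bounded: "\<exists>M>0. \<forall>\<zeta>\<in>V. \<forall>y. norm (blinfun_apply (S \<zeta>) y) \<le> M * norm y"
proof -
  obtain g where g: "\<And>x. norm (G x) \<le> norm x * g" "0 < g" using G.pos_bounded by blast
  obtain \<rho> where \<rho>: "\<And>y. norm (R y) \<le> norm y * \<rho>" "0 < \<rho>" using R.pos_bounded by blast
  show ?thesis
  proof (intro exI[of _ "2 * N * \<rho> * g"] conjI ballI allI)
    show "0 < 2 * N * \<rho> * g" using N g \<rho> by simp
    fix \<zeta> y assume z: "\<zeta> \<in> V"
    have "norm (blinfun_apply (S \<zeta>) y) \<le> norm (S1 \<zeta> (R y)) * g"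
      unfolding S_apply[OF z] by (rule g)
    also have "\<dots> \<le> (2 * N * norm (R y)) * g" using g by (intro mult_right_mono S1_le z) auto
    also have "\<dots> \<le> (2 * N * (norm y * \<rho>)) * g"
      using g N \<rho>(1)[of y] by (intro mult_right_mono mult_left_mono) auto
    finally show "norm (blinfun_apply (S \<zeta>) y) \<le> 2 * N * \<rho> * g * norm y" by (simp add: mult_ac)
  qed
qed

text \<open>Both sides equal \<open>j (R (j x)) - j x\<close>: the left one because \<open>R\<close>
  is a left inverse of \<open>G\<close>, the right one because it is a right inverse.\<close>

lemma R_j_A: "j (R (A x)) = A (R (j x))"
proof -
  have "R (j x) - R (A x) = x" using RG[of x] by (simp add: G_def R.diff)
  then have "j (R (A x)) = j (R (j x)) - j x" by (metis j.diff diff_diff_eq2 add_diff_cancel_left')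
  moreover have "j (R (j x)) - A (R (j x)) = j x" using GR[of "j x"] by (simp add: G_def)
  ultimately show ?thesis by (metis diff_diff_eq2 add_diff_cancel_left')
qed

text \<open>The resolvent commutes with \<open>A\<close>, hence maps orbits to orbits and commutes
  with \<open>S1\<close>. Thus the transported semigroup extends the one on the small space.\<close>

lemma S_j:
  assumes z: "\<zeta> \<in> V" shows "blinfun_apply (S \<zeta>) (j x) = j (S1 \<zeta> x)"
proof -
  have "solves_on {0..1} j (\<lambda>y. \<zeta> *\<^sub>C A y) (\<lambda>_. 0) (R (j x)) (\<lambda>t. R (j (orbit \<zeta> x t)))"
    unfolding solves_on_def
  proof (intro conjI ballI)
    show "continuous_on {0..1} (\<lambda>t. R (j (orbit \<zeta> x t)))"
      by (intro R.continuous_on j.continuous_on continuous_U z) auto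
    show "R (j (orbit \<zeta> x 0)) = R (j x)" by (simp add: orbit_0 z)
    fix t :: real assume "t \<in> {0..1}"
    then have "((\<lambda>t. j (orbit \<zeta> x t)) has_vector_derivative \<zeta> *\<^sub>C A (orbit \<zeta> x t) + 0)
        (at t within {0..1})"
      using orbit_solves[OF z, of x] unfolding solves_on_def by blast
    from j.has_vector_derivative[OF R.has_vector_derivative[OF this]]
    show "((\<lambda>t. j (R (j (orbit \<zeta> x t)))) has_vector_derivative
        \<zeta> *\<^sub>C A (R (j (orbit \<zeta> x t))) + 0) (at t within {0..1})"
      by (simp add: bounded_clinear_scaleC[OF clinear_R] bounded_clinear_scaleC[OF j] R_j_A)
  qed
  from U_unique[OF z _ this, of 1] have "S1 \<zeta> (R (j x)) = R (j (S1 \<zeta> x))"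
    by (simp add: S1_def)
  then show ?thesis by (simp add: S_apply z)
qed

text \<open>Integrate the derivative of the orbit over [0, 1]; \<open>A\<close> is bounded along
  orbits uniformly in \<open>\<zeta>\<close>.\<close>

lemma S_j_diff_le:
  assumes z: "\<zeta> \<in> V"
  shows "norm (blinfun_apply (S \<zeta>) (j x) - j x) \<le> (bound_A * (2 * N * norm x)) * norm \<zeta>"
proof -
  have "((\<lambda>t. \<zeta> *\<^sub>C A (orbit \<zeta> x t) + 0) has_integral (j (orbit \<zeta> x 1) - j (orbit \<zeta> x 0))) {0..1}"
    using orbit_solves[OF z, of x]
    by (intro fundamental_theorem_of_calculus) (auto simp: solves_on_def)
  then have "((\<lambda>t. \<zeta> *\<^sub>C A (orbit \<zeta> x t)) has_integral (blinfun_apply (S \<zeta>) (j x) - j x)) (cbox 0 1)"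
    by (simp add: S_j z S1_def orbit_0)
  from has_integral_bound[OF _ this, of "norm \<zeta> * (bound_A * (2 * N * norm x))"] show ?thesis
    using norm_A_le N A_orbit_le[OF z, of _ x] by (simp add: mult_left_mono mult.commute)
qed

text \<open>Density argument: on \<open>range j\<close> the error is at most linear in
  \<open>norm \<zeta>\<close>, and the uniform bound on \<open>V\<close> carries convergence over to
  every \<open>y\<close>.\<close>

lemma S_tendsto: "((\<lambda>\<zeta>. blinfun_apply (S \<zeta>) y) \<longlongrightarrow> y) (at 0 within V)"
proof (rule tendstoI)
  fix e :: real assume e: "0 < e"
  obtain M where M: "0 < M" "\<And>\<zeta> y. \<zeta> \<in> V \<Longrightarrow> norm (blinfun_apply (S \<zeta>) y) \<le> M * norm y"
    using S_bounded by blast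
  have "y \<in> closure (range j)" using dense by simp
  moreover have "0 < e / (2 * (M + 1))" using e M by simp
  ultimately obtain x where x: "dist (j x) y < e / (2 * (M + 1))"
    unfolding closure_approachable by blast
  have x': "(M + 1) * norm (j x - y) < e / 2"
    using x M by (simp add: dist_norm field_simps)
  define k where "k = bound_A * (2 * N * norm x)"
  have k: "0 \<le> k" using norm_A_le N by (simp add: k_def)
  define d where "d = e / (2 * (k + 1))"
  have d: "0 < d" using e k by (auto simp: d_def intro!: divide_pos_pos)
  have "dist (blinfun_apply (S \<zeta>) y) y < e" if z: "\<zeta> \<in> V" "dist \<zeta> 0 < d" for \<zeta>
  proof -
    have "blinfun_apply (S \<zeta>) y - y
        = blinfun_apply (S \<zeta>) (y - j x) + (blinfun_apply (S \<zeta>) (j x) - j x) + (j x - y)"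
      by (simp add: blinfun.diff_right)
    also have "norm \<dots> \<le> norm (blinfun_apply (S \<zeta>) (y - j x))
        + norm (blinfun_apply (S \<zeta>) (j x) - j x) + norm (j x - y)"
      by (rule order_trans[OF norm_triangle_ineq add_right_mono[OF norm_triangle_ineq]])
    also have "\<dots> \<le> M * norm (y - j x) + k * norm \<zeta> + norm (j x - y)"
      using M(2)[OF z(1), of "y - j x"] S_j_diff_le[OF z(1), of x] unfolding k_def
      by (intro add_mono order.refl)
    also have "\<dots> = (M + 1) * norm (j x - y) + k * norm \<zeta>"
      by (simp add: norm_minus_commute algebra_simps)
    also have "k * norm \<zeta> \<le> (k + 1) * norm \<zeta>"
      by (intro mult_right_mono) auto
    also have "(k + 1) * norm \<zeta> < e / 2"
      using z(2) k by (simp add: d_def field_simps)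
    finally show ?thesis using x' by (simp add: dist_norm)
  qed
  then show "\<forall>\<^sub>F \<zeta> in at 0 within V. dist (blinfun_apply (S \<zeta>) y) y < e"
    unfolding eventually_at using d by blast
qed

text \<open>In the right half plane \<open>Arg\<close> is the increasing function
  \<open>arctan\<close> of the slope, and an argument below \<open>arctan \<delta> < pi / 2\<close>
  forces a positive real part.\<close>

lemma sector_eq: "sector (arctan \<delta>) = V"
proof -
  have arg: "Arg z = arctan (Im z / Re z)" if "0 < Re z" for z
    using that by (rule arg_conv_arctan)
  have "(\<bar>arctan q\<bar> < arctan \<delta>) = (\<bar>q\<bar> < \<delta>)" for q
    by (metis abs_less_iff arctan_less_iff arctan_minus)
  then have *: "(\<bar>Arg z\<bar> < arctan \<delta>) = (\<bar>Im z\<bar> < \<delta> * Re z)" if "0 < Re z" for z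
    using that by (simp add: arg[OF that] abs_divide divide_less_eq)
  have "0 < Re z" if "z \<noteq> 0" "\<bar>Arg z\<bar> < arctan \<delta>" for z
    using that arctan_ubound[of \<delta>] Re_Ln_pos_lt[OF that(1)] by (simp add: Arg_eq_Im_Ln)
  then show ?thesis
    unfolding sector_def V_def using * by (auto simp: zero_complex.simps)
qed

lemma analytic_semigroup_S: "analytic_semigroup (arctan \<delta>) S"
  unfolding analytic_semigroup_def sector_eq
proof (intro conjI ballI allI impI)
  fix \<theta>' x assume "0 < \<theta>' \<and> \<theta>' < arctan \<delta>"
  then have "sector \<theta>' \<subseteq> V" unfolding sector_eq[symmetric] by (auto simp: sector_def)
  then show "((\<lambda>z. blinfun_apply (S z) x) \<longlongrightarrow> x) (at 0 within sector \<theta>')"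
    by (rule tendsto_within_subset[OF S_tendsto])
qed (simp_all add: clinear_S S_0 S_add S_differentiable)

section \<open>Real times and the generator\<close>

abbreviation T :: "real \<Rightarrow> 'a \<Rightarrow>\<^sub>L 'a" where "T t \<equiv> S (of_real t)"

lemma of_real_at_right_0: "filterlim of_real (at 0 within V) (at_right (0::real))"
  unfolding filterlim_at
proof
  show "((of_real :: real \<Rightarrow> complex) \<longlongrightarrow> 0) (at_right 0)" by (rule tendsto_eq_intros refl | simp)+
  show "\<forall>\<^sub>F t in at_right (0::real). complex_of_real t \<in> V \<and> complex_of_real t \<noteq> 0"
    using V_of_real by (auto simp: eventually_at_right[of 0 1] intro!: exI[of _ 1])
qed

lemma C0_semigroup_T: "C0_semigroup T"
  unfolding C0_semigroup_def
proof (intro conjI allI impI)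
  fix t :: real assume t: "0 \<le> t"
  show "bounded_clinear (blinfun_apply (T t))"
    using t V_of_real[of t] by (cases "t = 0") (auto simp: S_0 bounded_clinear_ident clinear_S id_blinfun.rep_eq id_def)
  fix s :: real assume s: "0 \<le> s"
  show "T (t + s) = T t o\<^sub>L T s"
  proof (cases "t = 0 \<or> s = 0")
    case True then show ?thesis by (auto simp: S_0 blinfun_eqI)
  next
    case False
    then show ?thesis using S_add[OF V_of_real V_of_real, of t s] s t by simp
  qed
next
  show "T 0 = id_blinfun" by (simp add: S_0)
  fix x
  show "continuous_on {0..} (\<lambda>t. blinfun_apply (T t) x)"
    unfolding continuous_on_eq_continuous_within
  proof
    fix t :: real assume t: "t \<in> {0..}"
    show "continuous (at t within {0..}) (\<lambda>t. blinfun_apply (T t) x)"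
    \<comment> \<open>At 0 the limit inside the sector is used; a positive time lies in the open set
      \<open>V\<close>, where complex differentiability gives continuity.\<close>
    proof (cases "t = 0")
      case True
      have "((\<lambda>t. blinfun_apply (T t) x) \<longlongrightarrow> x) (at_right 0)"
        by (rule filterlim_compose[OF S_tendsto of_real_at_right_0])
      then show ?thesis
        using True by (simp add: continuous_within S_0 at_within_Ici_at_right)
    next
      case False
      then have "of_real t \<in> V" using t V_of_real by simp
      then have "isCont S (of_real t)"
        using S_differentiable unfolding complex_differentiable_op_def
        by (blast intro: has_derivative_continuous)
      then have "isCont T t" by (intro isCont_o2[of t complex_of_real S]) (auto intro!: continuous_intros)
      then have "isCont (\<lambda>t. blinfun_apply (T t) x) t" by (intro continuous_intros)
      then show ?thesis by (rule continuous_at_imp_continuous_at_within)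
    qed
  qed
qed

text \<open>For small positive \<open>h\<close> the semigroup moves \<open>j x\<close> to
  \<open>j (orbit 1 x h)\<close>, so the limit is the right derivative of that orbit at 0, which the
  equation gives.\<close>

lemma generator_j: "((\<lambda>h. (blinfun_apply (T h) (j x) - j x) /\<^sub>R h) \<longlongrightarrow> A x) (at_right 0)"
proof -
  have V1: "1 \<in> V" using V_of_real[of 1] by simp
  have "((\<lambda>t. j (orbit 1 x t)) has_vector_derivative 1 *\<^sub>C A (orbit 1 x 0) + 0) (at 0 within {0..1})"
    using orbit_solves[OF V1, of x] unfolding solves_on_def by (meson atLeastAtMost_iff order.refl zero_le_one)
  then have "((\<lambda>t. j (orbit 1 x t)) has_vector_derivative A x) (at 0 within {0..1})"
    by (simp add: orbit_0 V1)
  then have "((\<lambda>h. (1 / norm (h - 0)) *\<^sub>R (j (orbit 1 x h) - (j (orbit 1 x 0) + (h - 0) *\<^sub>R A x)))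
      \<longlongrightarrow> 0) (at_right 0)"
    unfolding has_vector_derivative_def has_derivative_within
    by (simp add: at_within_Icc_at_right)
  moreover have "\<forall>\<^sub>F h in at_right 0.
      (1 / norm (h - 0)) *\<^sub>R (j (orbit 1 x h) - (j (orbit 1 x 0) + (h - 0) *\<^sub>R A x))
      = (j (orbit 1 x h) - j x) /\<^sub>R h - A x"
    by (auto simp: eventually_at_right[of 0 1] orbit_0 V1 scaleR_diff_right scaleR_add_right
        divide_inverse intro!: exI[of _ 1])
  ultimately have "((\<lambda>h. (j (orbit 1 x h) - j x) /\<^sub>R h - A x) \<longlongrightarrow> 0) (at_right 0)"
    by (rule Lim_transform_eventually)
  then have "((\<lambda>h. (j (orbit 1 x h) - j x) /\<^sub>R h) \<longlongrightarrow> A x) (at_right 0)"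
    by (simp add: LIM_zero_iff)
  moreover have "\<forall>\<^sub>F h in at_right 0. (j (orbit 1 x h) - j x) /\<^sub>R h
      = (blinfun_apply (T h) (j x) - j x) /\<^sub>R h"
    using S_j[OF V_of_real] S1_scale[OF V1]
    by (auto simp: eventually_at_right[of 0 1] intro!: exI[of _ 1])
  ultimately show ?thesis by (rule Lim_transform_eventually)
qed

lemma is_generator_T: "is_generator T (range j) (unbounded_op j A)"
  unfolding is_generator_def
proof (intro allI iffI)
  fix x y assume "x \<in> range j \<and> unbounded_op j A x = y"
  then obtain z where "x = j z" "A z = y" using inj by (auto simp: unbounded_op_def)
  then show "((\<lambda>h. (blinfun_apply (T h) x - x) /\<^sub>R h) \<longlongrightarrow> y) (at_right 0)"
    using generator_j by blast
next
  fix x y assume l: "((\<lambda>h. (blinfun_apply (T h) x - x) /\<^sub>R h) \<longlongrightarrow> y) (at_right 0)"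
  \<comment> \<open>\<open>j \<circ> R\<close> commutes with the semigroup and moves
    \<open>x\<close> into the domain, where the limit is already known.\<close>
  have "((\<lambda>h. j (R ((blinfun_apply (T h) x - x) /\<^sub>R h))) \<longlongrightarrow> j (R y)) (at_right 0)"
    by (intro j.tendsto R.tendsto l)
  moreover have "\<forall>\<^sub>F h in at_right 0. j (R ((blinfun_apply (T h) x - x) /\<^sub>R h))
      = (blinfun_apply (T h) (j (R x)) - j (R x)) /\<^sub>R h"
    using S_j[OF V_of_real] S_apply[OF V_of_real]
    by (auto simp: eventually_at_right[of 0 1] R.scaleR j.scaleR R.diff j.diff intro!: exI[of _ 1])
  ultimately have "((\<lambda>h. (blinfun_apply (T h) (j (R x)) - j (R x)) /\<^sub>R h) \<longlongrightarrow> j (R y)) (at_right 0)"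
    by (rule Lim_transform_eventually)
  with generator_j[of "R x"] have "A (R x) = j (R y)"
    by (intro tendsto_unique[OF trivial_limit_at_right_real])
  \<comment> \<open>Insert \<open>A (R x) = j (R y)\<close> into x = G (R x) = j (R x) - A (R
    x).\<close>
  then have x: "x = j (R x - R y)" using GR[of x] by (simp add: G_def j.diff)
  have "A (R x - R y) = y"
    using generator_j[of "R x - R y"] l unfolding x[symmetric]
    by (intro tendsto_unique[OF trivial_limit_at_right_real])
  then show "x \<in> range j \<and> unbounded_op j A x = y"
    using x inj by (metis inv_f_f rangeI unbounded_op_def)
qed

lemma generates: "generates_C0_analytic_semigroup (range j) (unbounded_op j A)"
  unfolding generates_C0_analytic_semigroup_def
  using C0_semigroup_T is_generator_T analytic_semigroup_S delta_pos arctan_ubound[of \<delta>]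
  by (intro exI[of _ T] conjI exI[of _ "arctan \<delta>"] exI[of _ S]) auto

end

section \<open>Shifting the generator\<close>

text \<open>Complex scaling as an operator, so that the product rule for composition applies to a
  scalar function times an operator function.\<close>

definition cmul :: "complex \<Rightarrow> 'a::complex_banach \<Rightarrow>\<^sub>L 'a" where
  "cmul c = Blinfun (\<lambda>x. c *\<^sub>C x)"

lemma cmul_apply [simp]: "blinfun_apply (cmul c) x = c *\<^sub>C x"
  by (simp add: cmul_def bounded_linear_Blinfun_apply scaleC.bounded_linear_right)

lemma bounded_linear_cmul: "bounded_linear cmul"
proof (rule bounded_linear_intro)
  show "cmul (x + y) = cmul x + cmul y" for x y
    by (rule blinfun_eqI) (simp add: blinfun.add_left scaleC_add_left)
  show "cmul (r *\<^sub>R x) = r *\<^sub>R cmul x" for r x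
    by (rule blinfun_eqI) (simp add: blinfun.scaleR_left scaleC.scaleR_left)
  show "norm (cmul x) \<le> norm x * 1" for x
    by (rule norm_blinfun_bound) simp_all
qed

lemma complex_differentiable_op_exp_mult:
  fixes S :: "complex \<Rightarrow> 'a::complex_banach \<Rightarrow>\<^sub>L 'a"
  assumes "complex_differentiable_op S z"
  shows "complex_differentiable_op (\<lambda>z. cmul (exp (\<omega> * z)) o\<^sub>L S z) z"
proof -
  obtain L D where L: "(S has_derivative L) (at z)" "\<And>h x. blinfun_apply (L h) x = h *\<^sub>C blinfun_apply D x"
    using assms unfolding complex_differentiable_op_def by blast
  have "((\<lambda>z. exp (\<omega> * z)) has_derivative (\<lambda>h. \<omega> * exp (\<omega> * z) * h)) (at z)"
    by (auto intro!: derivative_eq_intros)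
  from bounded_linear.has_derivative[OF bounded_linear_cmul this]
  have "((\<lambda>z. cmul (exp (\<omega> * z)) :: 'a \<Rightarrow>\<^sub>L 'a) has_derivative (\<lambda>h. cmul (\<omega> * exp (\<omega> * z) * h))) (at z)" .
  from bounded_bilinear.FDERIV[OF bounded_bilinear_blinfun_compose this L(1)]
  have "((\<lambda>z. cmul (exp (\<omega> * z)) o\<^sub>L S z) has_derivative
      (\<lambda>h. (cmul (exp (\<omega> * z)) o\<^sub>L L h) + (cmul (\<omega> * exp (\<omega> * z) * h) o\<^sub>L S z))) (at z)" .
  moreover have "blinfun_apply ((cmul (exp (\<omega> * z)) o\<^sub>L L h) + (cmul (\<omega> * exp (\<omega> * z) * h) o\<^sub>L S z)) x
      = h *\<^sub>C blinfun_apply ((cmul (exp (\<omega> * z)) o\<^sub>L D) + (cmul (\<omega> * exp (\<omega> * z)) o\<^sub>L S z)) x" for h x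
    by (simp add: blinfun.add_left L(2) scaleC_add_right scaleC_scaleC mult.commute)
  ultimately show ?thesis
    unfolding complex_differentiable_op_def by blast
qed

text \<open>The quotient splits into the exponential times the quotient of \<open>f\<close> and the
  quotient of the exponential times \<open>x\<close>.\<close>

lemma exp_mult_difference_quotient:
  fixes f :: "real \<Rightarrow> 'a::real_normed_vector"
  assumes "((\<lambda>h. (f h - x) /\<^sub>R h) \<longlongrightarrow> y) (at_right 0)"
  shows "((\<lambda>h. (exp (\<omega> * h) *\<^sub>R f h - x) /\<^sub>R h) \<longlongrightarrow> y + \<omega> *\<^sub>R x) (at_right 0)"
proof -
  have "((\<lambda>h. exp (\<omega> * h)) has_real_derivative \<omega>) (at 0)"
    by (auto intro!: derivative_eq_intros)
  then have "((\<lambda>h. (exp (\<omega> * h) - 1) / h) \<longlongrightarrow> \<omega>) (at 0)"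
    unfolding has_field_derivative_iff by simp
  then have e: "((\<lambda>h. (exp (\<omega> * h) - 1) / h) \<longlongrightarrow> \<omega>) (at_right 0)"
    by (rule tendsto_within_subset) simp
  have "((\<lambda>h. exp (\<omega> * h)) \<longlongrightarrow> exp (\<omega> * 0)) (at_right 0)"
    by (intro tendsto_intros)
  from tendsto_add[OF tendsto_scaleR[OF this assms] tendsto_scaleR[OF e tendsto_const[of x]]]
  have "((\<lambda>h. exp (\<omega> * h) *\<^sub>R ((f h - x) /\<^sub>R h) + ((exp (\<omega> * h) - 1) / h) *\<^sub>R x)
      \<longlongrightarrow> y + \<omega> *\<^sub>R x) (at_right 0)" by simp
  moreover have "exp (\<omega> * h) *\<^sub>R ((f h - x) /\<^sub>R h) + ((exp (\<omega> * h) - 1) / h) *\<^sub>R x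
      = (exp (\<omega> * h) *\<^sub>R f h - x) /\<^sub>R h" for h
    by (simp add: scaleR_diff_right scaleR_diff_left divide_inverse algebra_simps)
  ultimately show ?thesis by simp
qed

text \<open>Multiplying the semigroup by \<open>exp (of_real \<omega> * z)\<close> adds
  \<open>\<omega>\<close> to its generator and keeps the sector.\<close>

lemma generates_shift:
  fixes D :: "'a::complex_banach set" and \<omega> :: real
  assumes gen: "generates_C0_analytic_semigroup D B"
    and B': "\<And>x. x \<in> D \<Longrightarrow> B' x = B x + \<omega> *\<^sub>R x"
  shows "generates_C0_analytic_semigroup D B'"
proof -
  obtain S \<theta> S' where S: "C0_semigroup S" "is_generator S D B"
    and \<theta>: "0 < \<theta>" "\<theta> \<le> pi / 2" and S': "analytic_semigroup \<theta> S'"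
    and eq: "\<And>t. 0 \<le> t \<Longrightarrow> S' (of_real t) = S t"
    using gen unfolding generates_C0_analytic_semigroup_def by blast
  define E' where "E' z = cmul (exp (of_real \<omega> * z)) o\<^sub>L S' z" for z
  define E where "E t = exp (\<omega> * t) *\<^sub>R S t" for t
  have E'_apply: "blinfun_apply (E' z) x = exp (of_real \<omega> * z) *\<^sub>C blinfun_apply (S' z) x" for z x
    by (simp add: E'_def)
  have E'E: "E' (of_real t) = E t" if "0 \<le> t" for t
    using eq[OF that]
    by (intro blinfun_eqI) (simp add: E'_apply E_def blinfun.scaleR_left scaleC_of_real[symmetric] exp_of_real[symmetric])
  have "C0_semigroup E"
    unfolding C0_semigroup_def
  proof (intro conjI allI impI)
    show "E 0 = id_blinfun" using S by (simp add: E_def C0_semigroup_def)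
    fix t :: real assume t: "0 \<le> t"
    have "bounded_clinear (blinfun_apply (S t))" using S t by (simp add: C0_semigroup_def)
    moreover have "blinfun_apply (E t) = (\<lambda>x. of_real (exp (\<omega> * t)) *\<^sub>C blinfun_apply (S t) x)"
      by (rule ext) (simp only: E_def blinfun.scaleR_left scaleC_of_real)
    ultimately show "bounded_clinear (blinfun_apply (E t))"
      by (simp only: bounded_clinear_const_scaleC)
    fix s :: real assume s: "0 \<le> s"
    have "S (t + s) = S t o\<^sub>L S s" using S s t by (simp add: C0_semigroup_def)
    then show "E (t + s) = E t o\<^sub>L E s"
      by (intro blinfun_eqI) (simp add: E_def blinfun.scaleR_left blinfun.scaleR_right distrib_left exp_add)
  next
    fix x
    have "continuous_on {0..} (\<lambda>t. blinfun_apply (S t) x)" using S by (simp add: C0_semigroup_def)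
    from continuous_on_scaleR[OF _ this, of "\<lambda>t. exp (\<omega> * t)"]
    have "continuous_on {0..} (\<lambda>t. exp (\<omega> * t) *\<^sub>R blinfun_apply (S t) x)"
      by (simp add: continuous_intros)
    then show "continuous_on {0..} (\<lambda>t. blinfun_apply (E t) x)"
      by (simp add: E_def blinfun.scaleR_left)
  qed
  moreover have "is_generator E D B'"
    unfolding is_generator_def
  proof (intro allI)
    fix x y
    \<comment> \<open>One lemma serves both directions, since \<open>S\<close> is recovered from
      \<open>E\<close> by the factor with \<open>- \<omega>\<close>; hence the domain is exactly
      preserved.\<close>
    have "((\<lambda>h. (blinfun_apply (E h) x - x) /\<^sub>R h) \<longlongrightarrow> y) (at_right 0) \<longleftrightarrow>
      ((\<lambda>h. (blinfun_apply (S h) x - x) /\<^sub>R h) \<longlongrightarrow> y - \<omega> *\<^sub>R x) (at_right 0)"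
    proof
      assume "((\<lambda>h. (blinfun_apply (E h) x - x) /\<^sub>R h) \<longlongrightarrow> y) (at_right 0)"
      from exp_mult_difference_quotient[OF this, of "- \<omega>"]
      show "((\<lambda>h. (blinfun_apply (S h) x - x) /\<^sub>R h) \<longlongrightarrow> y - \<omega> *\<^sub>R x) (at_right 0)"
        by (simp add: E_def blinfun.scaleR_left exp_minus)
    next
      assume "((\<lambda>h. (blinfun_apply (S h) x - x) /\<^sub>R h) \<longlongrightarrow> y - \<omega> *\<^sub>R x) (at_right 0)"
      from exp_mult_difference_quotient[OF this, of \<omega>]
      show "((\<lambda>h. (blinfun_apply (E h) x - x) /\<^sub>R h) \<longlongrightarrow> y) (at_right 0)"
        by (simp add: E_def blinfun.scaleR_left)
    qed
    also have "\<dots> \<longleftrightarrow> x \<in> D \<and> B x = y - \<omega> *\<^sub>R x"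
      using S(2) unfolding is_generator_def by blast
    also have "\<dots> \<longleftrightarrow> x \<in> D \<and> B' x = y"
      using B' by (auto simp: eq_diff_eq)
    finally show "x \<in> D \<and> B' x = y \<longleftrightarrow>
        ((\<lambda>h. (blinfun_apply (E h) x - x) /\<^sub>R h) \<longlongrightarrow> y) (at_right 0)" by simp
  qed
  moreover have "analytic_semigroup \<theta> E'"
    unfolding analytic_semigroup_def
  proof (intro conjI ballI allI impI)
    show "E' 0 = id_blinfun"
      using S' by (intro blinfun_eqI) (simp add: E'_apply analytic_semigroup_def)
    fix z assume z: "z \<in> sector \<theta>"
    have cl: "bounded_clinear (blinfun_apply (S' z))" using S' z by (simp add: analytic_semigroup_def)
    have "blinfun_apply (E' z) = (\<lambda>x. exp (of_real \<omega> * z) *\<^sub>C blinfun_apply (S' z) x)"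
      by (rule ext) (rule E'_apply)
    with bounded_clinear_const_scaleC[OF cl] show "bounded_clinear (blinfun_apply (E' z))" by simp
    show "complex_differentiable_op E' z"
      unfolding E'_def[abs_def] using S' z
      by (intro complex_differentiable_op_exp_mult) (simp add: analytic_semigroup_def)
    fix w assume w: "w \<in> sector \<theta>"
    have "S' (z + w) = S' z o\<^sub>L S' w" using S' z w by (simp add: analytic_semigroup_def)
    then show "E' (z + w) = E' z o\<^sub>L E' w"
      by (intro blinfun_eqI)
        (simp add: E'_apply bounded_clinear_scaleC[OF cl] scaleC_scaleC distrib_left exp_add)
  next
    fix \<theta>' x assume "0 < \<theta>' \<and> \<theta>' < \<theta>"
    then have "((\<lambda>z. blinfun_apply (S' z) x) \<longlongrightarrow> x) (at 0 within sector \<theta>')"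
      using S' by (simp add: analytic_semigroup_def)
    moreover have "((\<lambda>z. exp (of_real \<omega> * z)) \<longlongrightarrow> exp (of_real \<omega> * 0)) (at 0 within sector \<theta>')"
      by (intro tendsto_intros)
    ultimately have "((\<lambda>z. exp (of_real \<omega> * z) *\<^sub>C blinfun_apply (S' z) x) \<longlongrightarrow> exp (of_real \<omega> * 0) *\<^sub>C x)
        (at 0 within sector \<theta>')"
      by (intro scaleC.tendsto)
    then show "((\<lambda>z. blinfun_apply (E' z) x) \<longlongrightarrow> x) (at 0 within sector \<theta>')"
      by (simp add: E'_apply)
  qed
  ultimately show ?thesis
    unfolding generates_C0_analytic_semigroup_def using \<theta> E'E by blast
qed

section \<open>The half line and the compact interval\<close>

theorem theorem2p2:
  fixes J :: "real set"
    and j :: "'b::complex_banach \<Rightarrow> 'a::complex_banach"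
    and A :: "'b \<Rightarrow> 'a"
  assumes J: "(\<exists>T>0. J = {0..T}) \<or> J = {0..}"
    and embedded: "densely_embedded j"
    and bounded: "bounded_clinear A"
    and closed: "closed_operator (range j) (unbounded_op j A)"
    and max_reg: "maximal_regularity J j A"
  shows "generates_C0_analytic_semigroup (range j) (unbounded_op j A) \<and>
         (J = {0..} \<longrightarrow> spectral_bound (range j) (unbounded_op j A) < 0)"
proof -
  have emb: "bounded_clinear j" "inj j" "closure (range j) = UNIV"
    using embedded by (auto simp: densely_embedded_def)
  obtain C where C: "1 \<le> C" and reg: "\<And>T. T \<in> J \<Longrightarrow> 0 < T \<Longrightarrow> regular_upto T j A C C"
    using maximal_regularity_imp_regular_upto[OF time_interval_cases[OF J]
        bounded_clinear_linear[OF emb(1)] emb(2) bounded_clinear_linear[OF bounded] max_reg] by metis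
  show ?thesis
  proof (cases "J = {0..}")
    case True
    \<comment> \<open>Every positive \<open>T\<close> belongs to the half line, so the causal
      estimates are already uniform.\<close>
    then have r: "regular j A C C" using reg by (simp add: regular_def)
    interpret regular_pair j A C C
      by unfold_locales (use emb bounded r C in auto)
    show ?thesis
      using generates regular_imp_spectral_bound_neg[OF emb(1,2) bounded r C] C by simp
  next
    case False
    then obtain T0 where T0: "0 < T0" "J = {0..T0}" using J by blast
    have "regular_upto T j A C C" if "0 < T" "T \<le> T0" for T
      using reg that T0 by simp
    from regular_upto_imp_regular_shifted[OF emb(1) bounded T0(1) C this]
    obtain \<omega> where r: "regular j (\<lambda>y. A y - complex_of_real \<omega> *\<^sub>C j y) (C + 2 * C * C) C"
      by metis
    have "0 \<le> 2 * C * C" using C by simp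
    then have C': "1 \<le> C + 2 * C * C" using C by linarith
    interpret shifted: regular_pair j "\<lambda>y. A y - complex_of_real \<omega> *\<^sub>C j y" "C + 2 * C * C" C
      by unfold_locales (use emb bounded_clinear_shifted[OF emb(1) bounded] r C C' in auto)
    \<comment> \<open>On the domain, \<open>A\<close> is the shifted operator plus
      \<open>\<omega>\<close>, so the shift is undone on the level of semigroups.\<close>
    have "generates_C0_analytic_semigroup (range j) (unbounded_op j A)"
      by (rule generates_shift[OF shifted.generates, of _ \<omega>])
        (use emb(2) in \<open>auto simp: unbounded_op_def scaleC_of_real\<close>)
    then show ?thesis using False by simp
  qed
qed

end
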